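(* Let $f:\mathbb{R}\to\mathbb{R}$ be continuously differentiable and periodic with period $T>0$, with $\|f'\|_\infty=1$. Let $(\varepsilon_t)_{t\ge1}$ be i.i.d. real random variables with density $f_\varepsilon$ satisfying $$M:=\sup_{u\in\mathbb{R}}\sum_{\ell\in\mathbb{Z}}f_\varepsilon(u+\ell T)<\infty .$$ For $a\in\mathbb{R}\setminus\{0\}$ put $r_a=af$ and consider the Markov chain $X_t=r_a(X_{t-1})+\varepsilon_t$. Let $\pi_a$ be an invariant probability measure of this chain, having a density with respect to the Lebesgue measure, and let $$\lambda_a=\int_{\mathbb{R}}\log|af'(x)|\,\pi_a(dx).$$ Suppose that $\int_0^T\log_-|f'(u)|\,du<\infty$ and that there exists $\delta_0>0$ such that, with $r=r_a$, $$\lim_{\eta\downarrow0}\ \sup_{0<|d|\le\delta_0}\int_0^T\mathbf{1}_{\{|r'(u)|\le\eta\}}\,\log_-\frac{|r(u+d)-r(u)|}{|d|}\,du=0 .$$ Then there exists $k_0<\infty$ such that, for every $a$ with $|a|>k_0$, $\lambda_a>0$. More precisely, $$\lambda_a\ge\log|a|-C_\varepsilon,\qquad\text{where } C_\varepsilon=M\int_0^T\bigl|\log|f'(u)|\bigr|\,du<\infty .$$ Moreover, if in addition $f_\varepsilon$ is positive everywhere and bounded below by a positive constant on every compact interval, then for every $a$ with $|a|>k_0$, with $D_n$ and $f_1^n$ as defined in the context (for $r=r_a$), $$\mathbb{P}\left(\lim_{n\to\infty}D_n=0\right)=0,$$ and, for Lebesgue-almost every $(x,y)\in\mathbb{R}^2$,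 $$\mathbb{P}\left(\lim_{n\to\infty}\left|f_1^n(x)-f_1^n(y)\right|=0\right)=0 .$$
   Context: Notation: $\log_-u=\max(-\log u,0)$ for $u>0$ and $\log_-0=+\infty$; an indicator equal to $0$ multiplied by $+\infty$ is $0$. When $f_\varepsilon$ is positive everywhere and bounded below on compact intervals, the chain $X_t=r_a(X_{t-1})+\varepsilon_t$ is uniformly ergodic and $\pi_a$ is its unique invariant probability measure. Definition of $D_n$ and $f_1^n$ (with $r=r_a$): let $X_0\sim\pi_a$ be independent of $(\varepsilon_t)_{t\ge1}$ and $X_t=r(X_{t-1})+\varepsilon_t$ for $t\ge1$. Let $\varepsilon'_1$ have the same distribution as $\varepsilon_1$ and be independent of $\sigma(X_0,\varepsilon_t:t\ge1)$. Set $X'_0=X_0$, $X'_1=r(X_0)+\varepsilon'_1$, $X'_t=r(X'_{t-1})+\varepsilon_t$ for $t\ge2$, and $D_t=X_t-X'_t$ for $t\ge1$. Furthermore $f_t(x)=r(x)+\varepsilon_t$ and $f_1^n=f_n\circ f_{n-1}\circ\cdots\circ f_1$. *)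

theory Defs
  imports "HOL-Probability.Probability"
begin

text \<open>Logarithm with \<open>log 0 = -\<infinity>\<close> (the library's \<^const>\<open>ln\<close> has \<open>ln 0 = 0\<close>); only used for
  \<open>u \<ge> 0\<close>.\<close>

definition ext_log :: "real \<Rightarrow> ereal" where
  "ext_log u = (if u = 0 then -\<infinity> else ereal (ln u))"

definition log_minus :: "real \<Rightarrow> ennreal" where
  "log_minus u = (if u = 0 then \<infinity> else ennreal (max (- ln u) 0))"

text \<open>Integral of an extended-real function as positive part minus negative part.  It has its usual
  meaning as soon as one of the two parts has finite integral; below, the integrand is
  bounded above and the measure is a probability measure, so the positive part is always finite.\<close>

definition ext_integral :: "'a measure \<Rightarrow> ('a \<Rightarrow> ereal) \<Rightarrow> ereal" where
  "ext_integral M g =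
     enn2ereal (\<integral>\<^sup>+ x. e2ennreal (g x) \<partial>M) - enn2ereal (\<integral>\<^sup>+ x. e2ennreal (- g x) \<partial>M)"

definition periodized_sup :: "(real \<Rightarrow> real) \<Rightarrow> real \<Rightarrow> ennreal" where
  "periodized_sup \<phi> T =
     (SUP u. \<Sum>\<^sub>\<infinity>l\<in>(UNIV :: int set). ennreal (\<phi> (u + of_int l * T)))"

definition C_eps :: "(real \<Rightarrow> real) \<Rightarrow> (real \<Rightarrow> real) \<Rightarrow> real \<Rightarrow> ennreal" where
  "C_eps f \<phi> T =
     periodized_sup \<phi> T * (\<integral>\<^sup>+ u\<in>{0..T}. e2ennreal \<bar>ext_log \<bar>deriv f u\<bar>\<bar> \<partial>lborel)"

definition small_derivative_condition :: "(real \<Rightarrow> real) \<Rightarrow> real \<Rightarrow> real \<Rightarrow> bool" where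
  "small_derivative_condition r T \<delta>0 \<longleftrightarrow>
     ((\<lambda>\<eta>::real. SUP d\<in>{d. 0 < \<bar>d\<bar> \<and> \<bar>d\<bar> \<le> \<delta>0}.
         \<integral>\<^sup>+ u\<in>{0..T}. (indicator {v. \<bar>deriv r v\<bar> \<le> \<eta>} u
             * log_minus (\<bar>r (u + d) - r u\<bar> / \<bar>d\<bar>)) \<partial>lborel) \<longlongrightarrow> 0) (at_right 0)"

text \<open>\<open>\<nu>\<close> is the law of the noise, so that the transition kernel of the chain is
  \<open>x \<mapsto> law of r x + \<epsilon>\<close>.\<close>

definition invariant_prob :: "(real \<Rightarrow> real) \<Rightarrow> real measure \<Rightarrow> real measure \<Rightarrow> bool" where
  "invariant_prob r \<nu> \<pi> \<longleftrightarrow>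
     prob_space \<pi> \<and> sets \<pi> = sets borel \<and>
     (\<forall>A\<in>sets borel. emeasure \<pi> A = (\<integral>\<^sup>+ x. emeasure (distr \<nu> borel (\<lambda>e. r x + e)) A \<partial>\<pi>))"

definition has_lebesgue_density :: "real measure \<Rightarrow> bool" where
  "has_lebesgue_density \<pi> \<longleftrightarrow> (\<exists>p\<in>borel_measurable lborel. \<pi> = density lborel p)"

definition lyapunov :: "(real \<Rightarrow> real) \<Rightarrow> real \<Rightarrow> real measure \<Rightarrow> ereal" where
  "lyapunov f a \<pi> = ext_integral \<pi> (\<lambda>x. ext_log \<bar>a * deriv f x\<bar>)"

text \<open>Independence of the sigma-algebras generated by \<open>X\<close> and \<open>Y\<close>.  The library's
  \<open>indep_var\<close> would force both variables to have the same value type.\<close>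

definition indep_rv ::
    "'w measure \<Rightarrow> 'a measure \<Rightarrow> ('w \<Rightarrow> 'a) \<Rightarrow> 'b measure \<Rightarrow> ('w \<Rightarrow> 'b) \<Rightarrow> bool" where
  "indep_rv P M X N Y \<longleftrightarrow>
     prob_space.indep_set P (sets (vimage_algebra (space P) X M))
       (sets (vimage_algebra (space P) Y N))"

abbreviation noise_space :: "(nat \<Rightarrow> real) measure" where
  "noise_space \<equiv> (\<Pi>\<^sub>M t\<in>{1..}. borel)"

abbreviation noise_seq :: "(nat \<Rightarrow> 'w \<Rightarrow> real) \<Rightarrow> 'w \<Rightarrow> nat \<Rightarrow> real" where
  "noise_seq \<epsilon> \<omega> \<equiv> (\<lambda>t\<in>{1..}. \<epsilon> t \<omega>)"

primrec chain :: "(real \<Rightarrow> real) \<Rightarrow> real \<Rightarrow> (nat \<Rightarrow> real) \<Rightarrow> nat \<Rightarrow> real" where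
  "chain r x e 0 = x"
| "chain r x e (Suc t) = r (chain r x e t) + e (Suc t)"

text \<open>The second chain starts from the same point and uses the same noise, except that the
  innovation at time 1 is \<open>e1\<close> instead of \<open>e 1\<close>.\<close>

definition chain_diff :: "(real \<Rightarrow> real) \<Rightarrow> real \<Rightarrow> (nat \<Rightarrow> real) \<Rightarrow> real \<Rightarrow> nat \<Rightarrow> real" where
  "chain_diff r x e e1 t = chain r x e t - chain r x (e(1 := e1)) t"

definition random_map :: "(real \<Rightarrow> real) \<Rightarrow> (nat \<Rightarrow> real) \<Rightarrow> nat \<Rightarrow> real \<Rightarrow> real" where
  "random_map r e t x = r x + e t"

primrec forward_comp :: "(real \<Rightarrow> real) \<Rightarrow> (nat \<Rightarrow> real) \<Rightarrow> nat \<Rightarrow> real \<Rightarrow> real" where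
  "forward_comp r e 0 = id"
| "forward_comp r e (Suc n) = random_map r e (Suc n) \<circ> forward_comp r e n"

end

theory Submission
  imports Defs
begin

text \<open>
  Write \<open>r = a f\<close> and let \<open>M\<close> be the supremum of the periodised noise density.  Whatever the
  past, the next state of the chain, reduced modulo \<open>T\<close>, has a density at most \<open>M\<close>.  So for
  every nonnegative \<open>T\<close>-periodic \<open>g\<close> the conditional expectation of \<open>g\<close> at the next state is at
  most \<open>M\<close> times the integral of \<open>g\<close> over one period (\<open>nn_integral_periodic_le\<close>).  Everything
  rests on this bound.

  For the Lyapunov exponent, apply it to \<open>g = log_minus \<bar>f'\<bar>\<close> under the invariant law.  Since
  \<open>\<bar>f'\<bar> \<le> 1\<close>, the bound is exactly \<open>C_eps\<close>, and
  \<open>log \<bar>a f'\<bar> = log \<bar>a\<bar> - log_minus \<bar>f'\<bar>\<close> gives \<open>lyapunov_ge\<close>.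

  For the orbits, let \<open>D\<close> be the current distance of two orbits driven by the same noise.  The
  next difference is \<open>r (u + D) - r u\<close>, where \<open>D\<close> is already known and \<open>u\<close> contains fresh noise.
  Hence the expected increment of \<open>log \<bar>D\<bar>\<close> is \<open>log \<bar>a\<bar>\<close> minus the average of \<open>log_minus\<close> of the
  difference quotient of \<open>f\<close> over step \<open>D\<close>, and that average is at most \<open>M\<close> times an integral
  over one period.  The condition on small derivatives, with uniform continuity of \<open>f'\<close>, bounds
  this integral by a constant \<open>L\<close> for all \<open>0 < \<bar>D\<bar> \<le> \<delta>\<close>
  (\<open>difference_quotient_log_bound\<close>).  So once \<open>log \<bar>a\<bar> > M L\<close>, the nonnegative function
  \<open>V = log_minus (\<bar>D\<bar> / (\<delta> \<bar>a\<bar>))\<close> has strictly negative drift as long as \<open>\<bar>D\<bar> \<le> \<delta>\<close>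
  (\<open>log_distance_drift\<close>).  A nonnegative process cannot drift down forever, hence two orbits that
  never meet are at distance more than \<open>\<delta>\<close> at infinitely many times (\<open>AE_drift_separates\<close>).
  This argument takes the place of an ergodic theorem for \<open>log \<bar>D\<bar>\<close>.

  Orbits that meet stay together, so meeting has to be excluded.  As \<open>f'\<close> vanishes only on a null
  set, preimages of null sets under \<open>r\<close>, and so under all compositions of the random maps, are
  null.  For each noise sequence almost no pair of starting points therefore ever meets, and
  Fubini's theorem turns this into an almost sure statement for almost every pair
  (\<open>AE_orbits_distinct\<close>).

  Finally \<open>D\<^sub>n\<close> is the distance, under the noise from time 2 on, of the orbits of the two states at
  time 1.  Given the initial state, these two states are independent with a density, so almost
  every pair of starting points is enough (\<open>AE_chain_diff_separated\<close>).
\<close>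

section \<open>Averaging periodic functions against the noise\<close>

lemma periodic_int_shift:
  fixes g :: "real \<Rightarrow> 'b" and T :: real
  assumes "\<And>x. g (x + T) = g x"
  shows "g (x + of_int l * T) = g x"
proof -
  have nat_shift: "g (y + of_nat n * T) = g y" for y n
  proof (induction n)
    case (Suc n)
    have "g (y + of_nat (Suc n) * T) = g ((y + of_nat n * T) + T)"
      by (simp add: algebra_simps)
    then show ?case using Suc assms by simp
  qed simp
  show ?thesis
  proof (cases "l \<ge> 0")
    case True
    then show ?thesis using nat_shift[of x "nat l"] by simp
  next
    case False
    then show ?thesis using nat_shift[of "x + of_int l * T" "nat (- l)"] by simp
  qed
qed

lemma periodic_representative:
  fixes g :: "real \<Rightarrow> 'b" and T :: real
  assumes "T > 0" "\<And>x. g (x + T) = g x"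
  obtains y where "y \<in> {0..<T}" "g y = g x"
proof
  let ?y = "x + of_int (- \<lfloor>x / T\<rfloor>) * T"
  show "?y \<in> {0..<T}"
    using floor_divide_lower[OF assms(1), of x] floor_divide_upper[OF assms(1), of x]
    by (simp add: algebra_simps)
  show "g ?y = g x" by (rule periodic_int_shift[where g=g, OF assms(2)])
qed

lemma sum_le_periodized_sup:
  assumes "finite F"
  shows "(\<Sum>l\<in>F. ennreal (\<phi> (u + of_int l * T))) \<le> periodized_sup \<phi> T"
proof -
  have "(\<Sum>l\<in>F. ennreal (\<phi> (u + of_int l * T)))
      \<le> (\<Sum>\<^sub>\<infinity>l\<in>(UNIV :: int set). ennreal (\<phi> (u + of_int l * T)))"
    by (subst nonneg_infsum_complete) (auto intro!: SUP_upper assms)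
  also have "\<dots> \<le> periodized_sup \<phi> T"
    unfolding periodized_sup_def by (rule SUP_upper) simp
  finally show ?thesis .
qed

text \<open>Enumerating the integers by \<open>int_decode\<close> turns the unordered sum into a series, to which
  monotone convergence for series applies.\<close>

lemma suminf_le_periodized_sup:
  "(\<Sum>n. ennreal (\<phi> (u + of_int (int_decode n) * T))) \<le> periodized_sup \<phi> T"
proof -
  have "(\<Sum>k<n. ennreal (\<phi> (u + of_int (int_decode k) * T))) \<le> periodized_sup \<phi> T" for n
  proof -
    have "(\<Sum>k<n. ennreal (\<phi> (u + of_int (int_decode k) * T)))
        = (\<Sum>l\<in>int_decode ` {..<n}. ennreal (\<phi> (u + of_int l * T)))"
      by (subst sum.reindex) (auto intro: inj_int_decode)
    then show ?thesis using sum_le_periodized_sup[of "int_decode ` {..<n}"] by simp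
  qed
  then show ?thesis by (simp add: suminf_eq_SUP SUP_le_iff)
qed

lemma nn_integral_split_periods:
  fixes h :: "real \<Rightarrow> ennreal" and T :: real
  assumes h[measurable]: "h \<in> borel_measurable borel" and T: "T > 0"
  shows "(\<integral>\<^sup>+v. h v \<partial>lborel)
    = (\<Sum>n. \<integral>\<^sup>+u. h (u + of_int (int_decode n) * T) * indicator {0..<T} u \<partial>lborel)"
proof -
  define I where "I n = {of_int (int_decode n) * T ..< of_int (int_decode n) * T + T}" for n
  have I_iff: "v \<in> I n \<longleftrightarrow> n = int_encode \<lfloor>v / T\<rfloor>" for v n
  proof -
    have "v \<in> I n \<longleftrightarrow> \<lfloor>v / T\<rfloor> = int_decode n"
      using T by (auto simp: I_def floor_eq_iff field_simps)
    then show ?thesis by (metis int_decode_inverse int_encode_inverse)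
  qed
  have [measurable]: "I n \<in> sets borel" for n unfolding I_def by simp
  have split: "h v = (\<Sum>n. h v * indicator (I n) v)" for v
  proof -
    have "(\<lambda>n. h v * indicator (I n) v) sums (\<Sum>n\<in>{int_encode \<lfloor>v / T\<rfloor>}. h v * indicator (I n) v)"
      by (rule sums_finite) (auto simp: I_iff)
    then have "(\<lambda>n. h v * indicator (I n) v) sums h v" by (simp add: I_iff)
    then show ?thesis by (simp add: sums_iff)
  qed
  have "(\<integral>\<^sup>+v. h v \<partial>lborel) = (\<integral>\<^sup>+v. (\<Sum>n. h v * indicator (I n) v) \<partial>lborel)"
    using split by simp
  also have "\<dots> = (\<Sum>n. \<integral>\<^sup>+v. h v * indicator (I n) v \<partial>lborel)"
    by (rule nn_integral_suminf) measurable
  also have "(\<lambda>n. \<integral>\<^sup>+v. h v * indicator (I n) v \<partial>lborel)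
      = (\<lambda>n. \<integral>\<^sup>+u. h (u + of_int (int_decode n) * T) * indicator {0..<T} u \<partial>lborel)"
    by (rule ext, subst nn_integral_real_affine[where c=1 and t="of_int (int_decode _) * T"])
       (auto simp: I_def indicator_def add.commute intro!: nn_integral_cong)
  finally show ?thesis .
qed

text \<open>Cutting the line into periods collects the density into its periodisation, because \<open>g\<close> is the
  same on every period; the starting point \<open>q\<close> only shifts the argument of the periodisation.\<close>

lemma nn_integral_periodic_le:
  fixes g :: "real \<Rightarrow> ennreal" and \<phi> :: "real \<Rightarrow> real" and T q :: real
  assumes g[measurable]: "g \<in> borel_measurable borel"
    and \<phi>[measurable]: "(\<lambda>u. ennreal (\<phi> u)) \<in> borel_measurable borel"
    and T: "T > 0" and per: "\<And>x. g (x + T) = g x"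
  shows "(\<integral>\<^sup>+e. g (q + e) * ennreal (\<phi> e) \<partial>lborel)
    \<le> periodized_sup \<phi> T * (\<integral>\<^sup>+u\<in>{0..T}. g u \<partial>lborel)"
proof -
  have [measurable]: "(\<lambda>u. ennreal (\<phi> (k u))) \<in> borel_measurable borel"
    if "k \<in> borel_measurable borel" for k :: "real \<Rightarrow> real"
    using measurable_compose[OF that \<phi>] .
  have "(\<integral>\<^sup>+e. g (q + e) * ennreal (\<phi> e) \<partial>lborel) = (\<integral>\<^sup>+v. g v * ennreal (\<phi> (v - q)) \<partial>lborel)"
    by (subst nn_integral_real_affine[where c=1 and t="-q"]) auto
  also have "\<dots> = (\<Sum>n. \<integral>\<^sup>+u. g (u + of_int (int_decode n) * T)
      * ennreal (\<phi> (u + of_int (int_decode n) * T - q)) * indicator {0..<T} u \<partial>lborel)"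
    by (rule nn_integral_split_periods[OF _ T]) measurable
  also have "\<dots> = (\<Sum>n. \<integral>\<^sup>+u. g u * indicator {0..<T} u
      * ennreal (\<phi> (u - q + of_int (int_decode n) * T)) \<partial>lborel)"
    using periodic_int_shift[of g T, OF per]
    by (intro suminf_cong nn_integral_cong) (auto simp: algebra_simps)
  also have "\<dots> = (\<integral>\<^sup>+u. (\<Sum>n. g u * indicator {0..<T} u
      * ennreal (\<phi> (u - q + of_int (int_decode n) * T))) \<partial>lborel)"
    by (rule nn_integral_suminf[symmetric]) measurable
  also have "\<dots> \<le> (\<integral>\<^sup>+u. periodized_sup \<phi> T * (g u * indicator {0..T} u) \<partial>lborel)"
  proof (intro nn_integral_mono)
    fix u
    have "(\<Sum>n. g u * indicator {0..<T} u * ennreal (\<phi> (u - q + of_int (int_decode n) * T)))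
        = g u * indicator {0..<T} u * (\<Sum>n. ennreal (\<phi> (u - q + of_int (int_decode n) * T)))"
      by simp
    also have "\<dots> \<le> (g u * indicator {0..T} u) * periodized_sup \<phi> T"
      by (intro mult_mono suminf_le_periodized_sup) (auto simp: indicator_def)
    finally show "(\<Sum>n. g u * indicator {0..<T} u * ennreal (\<phi> (u - q + of_int (int_decode n) * T)))
        \<le> periodized_sup \<phi> T * (g u * indicator {0..T} u)" by (simp add: mult.commute)
  qed
  also have "\<dots> = periodized_sup \<phi> T * (\<integral>\<^sup>+u\<in>{0..T}. g u \<partial>lborel)"
    by (rule nn_integral_cmult) measurable
  finally show ?thesis .
qed

section \<open>Logarithms of slopes\<close>

lemma log_minus_measurable[measurable]: "log_minus \<in> borel_measurable borel"
  unfolding log_minus_def by measurable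

lemma ext_log_measurable[measurable]: "ext_log \<in> borel_measurable borel"
  unfolding ext_log_def by measurable

lemma abs_ext_log_eq_log_minus:
  assumes "0 \<le> u" "u \<le> 1"
  shows "e2ennreal \<bar>ext_log u\<bar> = log_minus u"
proof (cases "u = 0")
  case False
  then have "ln u \<le> 0" using assms by simp
  then show ?thesis using False by (simp add: ext_log_def log_minus_def)
qed (simp add: ext_log_def log_minus_def)

lemma log_minus_antimono:
  assumes "0 \<le> u" "u \<le> v"
  shows "log_minus v \<le> log_minus u"
  using assms by (auto simp: log_minus_def intro!: ennreal_leI max.mono)

lemma log_minus_eq_ln: "0 < u \<Longrightarrow> u \<le> 1 \<Longrightarrow> log_minus u = ennreal (- ln u)"
  by (simp add: log_minus_def max_def)

text \<open>The chain rule for one step of the difference process, with \<open>h\<close> the increment of \<open>f\<close> over step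
  \<open>d\<close>.  The normalisation \<open>\<delta> * \<bar>a\<bar>\<close> keeps both normalised distances at most 1, where
  \<open>log_minus\<close> is minus the logarithm, so that the identity is exact and needs no
  subtraction of possibly infinite values.\<close>

lemma log_minus_scaled_eq:
  fixes a d h \<delta> :: real
  assumes "\<bar>a\<bar> \<ge> 1" "0 < \<bar>d\<bar>" "\<bar>d\<bar> \<le> \<delta>" "\<bar>h\<bar> \<le> \<bar>d\<bar>"
  shows "log_minus (\<bar>a * h\<bar> / (\<delta> * \<bar>a\<bar>)) + ennreal (ln \<bar>a\<bar>)
    = log_minus (\<bar>d\<bar> / (\<delta> * \<bar>a\<bar>)) + log_minus (\<bar>h\<bar> / \<bar>d\<bar>)"
proof (cases "h = 0")
  case False
  have pos: "\<delta> > 0" "\<bar>a\<bar> > 0" using assms by auto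
  have r1: "\<bar>a * h\<bar> / (\<delta> * \<bar>a\<bar>) = \<bar>h\<bar> / \<delta>" using pos by (simp add: abs_mult)
  have le: "\<bar>h\<bar> / \<delta> \<le> 1" "\<bar>d\<bar> / (\<delta> * \<bar>a\<bar>) \<le> 1" "\<bar>h\<bar> / \<bar>d\<bar> \<le> 1"
    using assms pos mult_mono[of "\<bar>d\<bar>" \<delta> 1 "\<bar>a\<bar>"] by (auto simp: divide_simps)
  have gt: "0 < \<bar>h\<bar> / \<delta>" "0 < \<bar>d\<bar> / (\<delta> * \<bar>a\<bar>)" "0 < \<bar>h\<bar> / \<bar>d\<bar>"
    using False pos assms by auto
  have "- ln (\<bar>h\<bar> / \<delta>) + ln \<bar>a\<bar> = - ln (\<bar>d\<bar> / (\<delta> * \<bar>a\<bar>)) + - ln (\<bar>h\<bar> / \<bar>d\<bar>)"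
    using pos assms False by (subst (1 2 3) ln_div) (auto simp: ln_mult)
  moreover have "0 \<le> - ln (\<bar>h\<bar> / \<delta>)" "0 \<le> - ln (\<bar>d\<bar> / (\<delta> * \<bar>a\<bar>))" "0 \<le> - ln (\<bar>h\<bar> / \<bar>d\<bar>)"
    "0 \<le> ln \<bar>a\<bar>"
    using ln_le_zero_iff[OF gt(1)] ln_le_zero_iff[OF gt(2)] ln_le_zero_iff[OF gt(3)] le assms(1)
      ln_ge_zero[OF assms(1)] by linarith+
  ultimately have "ennreal (- ln (\<bar>h\<bar> / \<delta>)) + ennreal (ln \<bar>a\<bar>)
      = ennreal (- ln (\<bar>d\<bar> / (\<delta> * \<bar>a\<bar>))) + ennreal (- ln (\<bar>h\<bar> / \<bar>d\<bar>))"
    by (metis ennreal_plus)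
  then show ?thesis
    unfolding r1 log_minus_eq_ln[OF gt(1) le(1)] log_minus_eq_ln[OF gt(2) le(2)]
      log_minus_eq_ln[OF gt(3) le(3)] .
qed (use assms in \<open>auto simp: log_minus_def\<close>)

section \<open>Periodic maps with slopes bounded by one\<close>

locale periodic_C1_map =
  fixes f :: "real \<Rightarrow> real" and T :: real
  assumes C1: "f C1_differentiable_on UNIV"
    and T_pos: "T > 0"
    and periodic: "f (x + T) = f x"
    and deriv_le_1: "\<bar>deriv f x\<bar> \<le> 1"


lemma C1_deriv_properties:
  fixes f :: "real \<Rightarrow> real"
  assumes "f C1_differentiable_on UNIV"
  shows "(f has_real_derivative deriv f x) (at x)" "continuous_on UNIV (deriv f)"
proof -
  obtain D where D: "\<And>x. (f has_vector_derivative D x) (at x)" "continuous_on UNIV D"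
    using assms unfolding C1_differentiable_on_def by auto
  then have "deriv f = D"
    by (auto intro!: ext DERIV_imp_deriv simp: has_real_derivative_iff_has_vector_derivative)
  with D show "(f has_real_derivative deriv f x) (at x)" "continuous_on UNIV (deriv f)"
    by (auto simp: has_real_derivative_iff_has_vector_derivative)
qed

lemma deriv_periodic:
  fixes f :: "real \<Rightarrow> real"
  assumes "f C1_differentiable_on UNIV" "\<And>x. f (x + T) = f x"
  shows "deriv f (x + T) = deriv f x"
proof -
  have "((\<lambda>y. f (y + T)) has_real_derivative deriv f (x + T)) (at x)"
    using C1_deriv_properties(1)[OF assms(1), of "x + T"] by (simp add: DERIV_shift)
  then show ?thesis
    using assms(2) C1_deriv_properties(1)[OF assms(1), of x] by (simp add: DERIV_unique)
qed

lemma periodic_C1_mapI: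
  fixes f :: "real \<Rightarrow> real"
  assumes C1: "f C1_differentiable_on UNIV" and T: "T > 0" and per: "\<And>x. f (x + T) = f x"
    and norm: "(SUP x. \<bar>deriv f x\<bar>) = 1"
  shows "periodic_C1_map f T"
proof
  fix x
  have "range (\<lambda>x. \<bar>deriv f x\<bar>) \<subseteq> (\<lambda>x. \<bar>deriv f x\<bar>) ` {0..T}"
  proof safe
    fix x
    obtain y where "y \<in> {0..<T}" "deriv f y = deriv f x"
      by (rule periodic_representative[of T "deriv f" x, OF T deriv_periodic[OF C1 per]])
    then show "\<bar>deriv f x\<bar> \<in> (\<lambda>x. \<bar>deriv f x\<bar>) ` {0..T}" by (auto intro!: image_eqI[of _ _ y])
  qed
  moreover have "bounded ((\<lambda>x. \<bar>deriv f x\<bar>) ` {0..T})"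
    by (intro compact_imp_bounded compact_continuous_image continuous_intros
        continuous_on_subset[OF C1_deriv_properties(2)[OF C1]]) auto
  ultimately have "bdd_above (range (\<lambda>x. \<bar>deriv f x\<bar>))"
    by (meson bdd_above_mono bounded_imp_bdd_above)
  then show "\<bar>deriv f x\<bar> \<le> 1" using cSUP_upper[of x UNIV "\<lambda>x. \<bar>deriv f x\<bar>"] norm by simp
qed (use assms in auto)

context periodic_C1_map
begin

lemmas has_deriv = C1_deriv_properties(1)[OF C1]
lemmas continuous_deriv = C1_deriv_properties(2)[OF C1]
lemmas deriv_shift = deriv_periodic[OF C1 periodic]

lemma continuous: "continuous_on UNIV f"
  using has_deriv by (meson DERIV_isCont continuous_at_imp_continuous_on)

lemma measurable_f[measurable]: "f \<in> borel_measurable borel"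
  by (rule borel_measurable_continuous_onI[OF continuous])

lemma measurable_deriv[measurable]: "deriv f \<in> borel_measurable borel"
  by (rule borel_measurable_continuous_onI[OF continuous_deriv])

lemma mean_value:
  obtains \<xi> where "\<bar>\<xi> - u\<bar> \<le> \<bar>d\<bar>" "f (u + d) - f u = d * deriv f \<xi>"
proof -
  consider "d = 0" | "d > 0" | "d < 0" by linarith
  then show ?thesis
  proof cases
    case 1 then show ?thesis using that[of u] by simp
  next
    case 2
    then obtain z where "u < z" "z < u + d" "f (u + d) - f u = (u + d - u) * deriv f z"
      using MVT2[of u "u + d" f "deriv f"] has_deriv by auto
    then show ?thesis using that[of z] by auto
  next
    case 3
    then obtain z where "u + d < z" "z < u" "f u - f (u + d) = (u - (u + d)) * deriv f z"
      using MVT2[of "u + d" u f "deriv f"] has_deriv by auto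
    then show ?thesis using that[of z] by (auto simp: algebra_simps)
  qed
qed

lemma lipschitz: "\<bar>f (u + d) - f u\<bar> \<le> \<bar>d\<bar>"
proof -
  obtain \<xi> where "f (u + d) - f u = d * deriv f \<xi>" by (rule mean_value)
  then show ?thesis using mult_left_mono[OF deriv_le_1, of "\<bar>d\<bar>"] by (simp add: abs_mult)
qed

text \<open>Where \<open>\<bar>f'\<bar>\<close> is at most a small \<open>\<eta>\<close>, the integral is controlled by the condition on small
  derivatives; elsewhere the mean value theorem and uniform continuity keep the difference
  quotient above \<open>\<eta> / 2\<close>.\<close>

lemma difference_quotient_log_bound:
  assumes cond: "small_derivative_condition f T \<delta>0" and "\<delta>0 > 0"
  obtains \<delta> L :: real where "\<delta> > 0" "L \<ge> 0"
    "\<And>d. 0 < \<bar>d\<bar> \<Longrightarrow> \<bar>d\<bar> \<le> \<delta> \<Longrightarrow>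
      (\<integral>\<^sup>+u\<in>{0..T}. log_minus (\<bar>f (u + d) - f u\<bar> / \<bar>d\<bar>) \<partial>lborel) \<le> ennreal L"
proof -
  define S where "S \<eta> = (SUP d\<in>{d. 0 < \<bar>d\<bar> \<and> \<bar>d\<bar> \<le> \<delta>0}.
         \<integral>\<^sup>+ u\<in>{0..T}. (indicator {v. \<bar>deriv f v\<bar> \<le> \<eta>} u
             * log_minus (\<bar>f (u + d) - f u\<bar> / \<bar>d\<bar>)) \<partial>lborel)" for \<eta> :: real
  have "(S \<longlongrightarrow> 0) (at_right 0)"
    using cond unfolding small_derivative_condition_def S_def .
  then have "eventually (\<lambda>\<eta>. S \<eta> < 1) (at_right 0)"
    by (rule order_tendstoD) simp
  then obtain \<eta> where \<eta>: "\<eta> > 0" "S \<eta> < 1"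
    unfolding eventually_at_right_field by (metis dense)
  \<comment> \<open>One period enlarged by 1 on each side contains \<open>u + d\<close> for \<open>u\<close> in the period and
    \<open>\<bar>d\<bar> \<le> 1\<close>.\<close>
  have "uniformly_continuous_on {- 1..T + 1} (deriv f)"
    by (intro compact_uniformly_continuous continuous_on_subset[OF continuous_deriv]) auto
  then obtain \<delta>1 where \<delta>1: "\<delta>1 > 0"
    "\<And>x y. x \<in> {- 1..T + 1} \<Longrightarrow> y \<in> {- 1..T + 1} \<Longrightarrow> dist y x < \<delta>1 \<Longrightarrow>
      dist (deriv f y) (deriv f x) < \<eta> / 2"
    unfolding uniformly_continuous_on_def using \<eta>(1) by (meson half_gt_zero)
  define \<delta> where "\<delta> = min \<delta>0 (min 1 (\<delta>1 / 2))"
  define l where "l = max (- ln (\<eta> / 2)) 0"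
  have bound: "(\<integral>\<^sup>+u\<in>{0..T}. log_minus (\<bar>f (u + d) - f u\<bar> / \<bar>d\<bar>) \<partial>lborel) \<le> ennreal (1 + l * T)"
    if d: "0 < \<bar>d\<bar>" "\<bar>d\<bar> \<le> \<delta>" for d
  proof -
    let ?q = "\<lambda>u. log_minus (\<bar>f (u + d) - f u\<bar> / \<bar>d\<bar>)"
    have pointwise: "?q u * indicator {0..T} u
        \<le> indicator {v. \<bar>deriv f v\<bar> \<le> \<eta>} u * ?q u * indicator {0..T} u
          + ennreal l * indicator {0..T} u" for u
    proof (cases "u \<in> {0..T} \<and> \<bar>deriv f u\<bar> > \<eta>")
      case True
      obtain \<xi> where \<xi>: "\<bar>\<xi> - u\<bar> \<le> \<bar>d\<bar>" "f (u + d) - f u = d * deriv f \<xi>" by (rule mean_value)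
      have "\<bar>deriv f \<xi> - deriv f u\<bar> < \<eta> / 2"
      proof -
        have "\<bar>d\<bar> \<le> 1" "\<bar>d\<bar> < \<delta>1" using d \<delta>1(1) by (auto simp: \<delta>_def)
        then have "\<xi> \<in> {- 1..T + 1}" "dist \<xi> u < \<delta>1"
          using \<xi>(1) True by (auto simp: dist_real_def abs_le_iff)
        then show ?thesis using \<delta>1(2)[of u \<xi>] True by (auto simp: dist_real_def)
      qed
      then have "\<eta> / 2 \<le> \<bar>deriv f \<xi>\<bar>" using True by linarith
      also have "\<dots> = \<bar>f (u + d) - f u\<bar> / \<bar>d\<bar>" using d(1) by (simp add: \<xi>(2) abs_mult)
      finally have "?q u \<le> log_minus (\<eta> / 2)" using \<eta>(1) by (intro log_minus_antimono) auto
      also have "\<dots> = ennreal l" using \<eta>(1) by (simp add: log_minus_def l_def)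
      finally show ?thesis using True by simp
    qed (auto simp: indicator_def)
    have "(\<integral>\<^sup>+u\<in>{0..T}. ?q u \<partial>lborel)
        \<le> (\<integral>\<^sup>+u. indicator {v. \<bar>deriv f v\<bar> \<le> \<eta>} u * ?q u * indicator {0..T} u
            + ennreal l * indicator {0..T} u \<partial>lborel)"
      by (intro nn_integral_mono pointwise)
    also have "\<dots> = (\<integral>\<^sup>+u\<in>{0..T}. (indicator {v. \<bar>deriv f v\<bar> \<le> \<eta>} u * ?q u) \<partial>lborel)
        + (\<integral>\<^sup>+u. ennreal l * indicator {0..T} u \<partial>lborel)"
      by (rule nn_integral_add) measurable
    also have "\<dots> \<le> S \<eta> + ennreal l * ennreal T"
      using d T_pos unfolding S_def \<delta>_def
      by (intro add_mono SUP_upper) (auto simp: nn_integral_cmult)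
    also have "\<dots> \<le> 1 + ennreal l * ennreal T"
      using \<eta>(2) by (intro add_mono) auto
    also have "\<dots> = ennreal (1 + l * T)"
      using T_pos by (simp add: l_def ennreal_mult)
    finally show ?thesis .
  qed
  show ?thesis
    using bound assms(2) \<delta>1(1) T_pos by (intro that[of \<delta> "1 + l * T"]) (auto simp: \<delta>_def l_def)
qed

lemma negligible_critical_points:
  assumes "(\<integral>\<^sup>+ u\<in>{0..T}. log_minus \<bar>deriv f u\<bar> \<partial>lborel) < \<infinity>"
  shows "negligible {x. deriv f x = 0}"
proof -
  have [measurable]: "{x. deriv f x = 0} \<in> sets borel" by measurable
  have "AE u in lborel. log_minus \<bar>deriv f u\<bar> * indicator {0..T} u \<noteq> \<infinity>"
    using assms by (intro nn_integral_PInf_AE) auto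
  then have "AE u in lborel. u \<in> {0..T} \<longrightarrow> deriv f u \<noteq> 0"
    by eventually_elim (auto simp: log_minus_def)
  then have zero: "(\<integral>\<^sup>+u. indicator {x. deriv f x = 0} u * indicator {0..<T} u \<partial>lborel) = 0"
    by (subst nn_integral_0_iff_AE, measurable) (auto elim!: eventually_mono simp: indicator_def)
  have "emeasure lborel {x. deriv f x = 0} = (\<integral>\<^sup>+u. indicator {x. deriv f x = 0} u \<partial>lborel)"
    by simp
  also have "\<dots> = (\<Sum>n. \<integral>\<^sup>+u. indicator {x. deriv f x = 0} (u + of_int (int_decode n) * T)
      * indicator {0..<T} u \<partial>lborel)"
    by (rule nn_integral_split_periods[OF _ T_pos]) measurable
  also have "\<dots> = 0"
    using zero periodic_int_shift[of "deriv f" T, OF deriv_shift] by (simp add: indicator_def)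
  finally show ?thesis
    by (simp add: negligible_iff_null_sets null_sets_completionI null_sets_def)
qed

end

section \<open>Preimages of null sets\<close>

lemma negligible_vimage_nonzero_deriv:
  fixes g :: "real \<Rightarrow> real"
  assumes "\<And>x. (g has_real_derivative g' x) (at x)" "negligible {x. g' x = 0}" "negligible N"
  shows "negligible {x. g x \<in> N}"
proof -
  have "negligible {x \<in> {x. g' x \<noteq> 0}. g x \<in> N}"
    using assms(1)
    by (intro negligible_differentiable_vimage[where f'="\<lambda>x h. g' x * h"] assms(3))
       (auto simp: inj_def has_field_derivative_def has_derivative_at_withinI)
  then have "negligible ({x \<in> {x. g' x \<noteq> 0}. g x \<in> N} \<union> {x. g' x = 0})"
    using assms(2) by (rule negligible_Un)
  then show ?thesis by (rule negligible_subset) auto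
qed

text \<open>The pull-back proceeds step by step through null sets and not through points: the preimage of a point under \<open>r\<close>
  may be an uncountable null set.\<close>

lemma negligible_forward_comp_vimage:
  assumes r: "\<And>N. negligible N \<Longrightarrow> negligible {x. r x \<in> N}"
  shows "negligible N \<Longrightarrow> negligible {x. forward_comp r e n x \<in> N}"
proof (induction n arbitrary: N)
  case (Suc n)
  have "negligible ((\<lambda>x. - e (Suc n) + x) ` N)" by (rule negligible_translation[OF Suc.prems])
  then have "negligible {x. forward_comp r e n x \<in> {z. r z \<in> (\<lambda>x. - e (Suc n) + x) ` N}}"
    by (intro Suc.IH r)
  then show ?case
    by (rule negligible_subset) (auto simp: random_map_def intro!: image_eqI[where x="r _ + e _"])
qed simp

section \<open>The Lyapunov exponent\<close>

text \<open>By invariance a state under \<open>\<pi>\<close> has the law of \<open>r x + e\<close> with independent noise \<open>e\<close>, so the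
  one-step bound for periodic functions carries over to \<open>\<pi>\<close>.\<close>

lemma nn_integral_invariant_le:
  fixes g :: "real \<Rightarrow> ennreal"
  assumes inv: "invariant_prob r (density lborel (\<lambda>u. ennreal (\<phi> u))) \<pi>"
    and r[measurable]: "r \<in> borel_measurable borel"
    and \<phi>[measurable]: "(\<lambda>u. ennreal (\<phi> u)) \<in> borel_measurable borel"
    and \<nu>: "prob_space (density lborel (\<lambda>u. ennreal (\<phi> u)))"
    and g[measurable]: "g \<in> borel_measurable borel"
    and T: "T > 0" and per: "\<And>x. g (x + T) = g x"
  shows "(\<integral>\<^sup>+x. g x \<partial>\<pi>) \<le> periodized_sup \<phi> T * (\<integral>\<^sup>+u\<in>{0..T}. g u \<partial>lborel)"
proof -
  define \<nu> where "\<nu> = density lborel (\<lambda>u. ennreal (\<phi> u))"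
  interpret \<nu>: prob_space \<nu> using \<nu> by (simp add: \<nu>_def)
  interpret \<pi>: prob_space \<pi> using inv by (simp add: invariant_prob_def)
  have sets_\<pi>[measurable_cong]: "sets \<pi> = sets borel" using inv by (simp add: invariant_prob_def)
  have sets_\<nu>[measurable_cong]: "sets \<nu> = sets borel" by (simp add: \<nu>_def)
  have "\<pi> = distr (\<pi> \<Otimes>\<^sub>M \<nu>) borel (\<lambda>(x, e). r x + e)"
  proof (rule measure_eqI)
    fix A assume "A \<in> sets \<pi>"
    then have A[measurable]: "A \<in> sets borel" by (simp add: sets_\<pi>)
    have "emeasure (distr (\<pi> \<Otimes>\<^sub>M \<nu>) borel (\<lambda>(x, e). r x + e)) A
        = (\<integral>\<^sup>+x. emeasure \<nu> (Pair x -` ((\<lambda>(x, e). r x + e) -` A \<inter> space (\<pi> \<Otimes>\<^sub>M \<nu>))) \<partial>\<pi>)"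
      by (subst emeasure_distr, measurable, subst \<nu>.emeasure_pair_measure_alt) auto
    also have "\<dots> = (\<integral>\<^sup>+x. emeasure (distr \<nu> borel (\<lambda>e. r x + e)) A \<partial>\<pi>)"
    proof (rule nn_integral_cong)
      fix x assume "x \<in> space \<pi>"
      show "emeasure \<nu> (Pair x -` ((\<lambda>(x, e). r x + e) -` A \<inter> space (\<pi> \<Otimes>\<^sub>M \<nu>)))
          = emeasure (distr \<nu> borel (\<lambda>e. r x + e)) A"
        using \<open>x \<in> space \<pi>\<close>
        by (subst emeasure_distr, measurable)
           (auto simp: space_pair_measure intro!: arg_cong[where f="emeasure \<nu>"])
    qed
    also have "\<dots> = emeasure \<pi> A"
      using inv by (simp add: invariant_prob_def \<nu>_def)
    finally show "emeasure \<pi> A = emeasure (distr (\<pi> \<Otimes>\<^sub>M \<nu>) borel (\<lambda>(x, e). r x + e)) A" ..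
  qed (simp add: sets_\<pi>)
  then have "(\<integral>\<^sup>+x. g x \<partial>\<pi>) = (\<integral>\<^sup>+x. g x \<partial>distr (\<pi> \<Otimes>\<^sub>M \<nu>) borel (\<lambda>(x, e). r x + e))"
    by simp
  also have "\<dots> = (\<integral>\<^sup>+x. \<integral>\<^sup>+e. g (r x + e) \<partial>\<nu> \<partial>\<pi>)"
    by (subst nn_integral_distr, measurable, subst \<nu>.nn_integral_fst[symmetric]) auto
  also have "\<dots> = (\<integral>\<^sup>+x. \<integral>\<^sup>+e. g (r x + e) * ennreal (\<phi> e) \<partial>lborel \<partial>\<pi>)"
    unfolding \<nu>_def by (subst nn_integral_density) (auto simp: mult.commute)
  also have "\<dots> \<le> (\<integral>\<^sup>+x. periodized_sup \<phi> T * (\<integral>\<^sup>+u\<in>{0..T}. g u \<partial>lborel) \<partial>\<pi>)"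
    by (intro nn_integral_mono nn_integral_periodic_le g \<phi> T per)
  also have "\<dots> = periodized_sup \<phi> T * (\<integral>\<^sup>+u\<in>{0..T}. g u \<partial>lborel)"
    by (simp add: \<pi>.emeasure_space_1)
  finally show ?thesis .
qed

text \<open>The identity \<open>log (\<bar>a\<bar> u) = log \<bar>a\<bar> - log_minus u\<close>, written with positive and negative parts on
  the sides where they can be added, so that it also holds for \<open>u = 0\<close>.  As \<open>ennreal\<close> sends
  negative reals to 0, \<open>ennreal (- ln \<bar>a\<bar>)\<close> and \<open>ennreal (ln \<bar>a\<bar>)\<close> are the two parts of
  \<open>ln \<bar>a\<bar>\<close>.\<close>

lemma ext_log_mult_balance:
  assumes "a \<noteq> 0" "0 \<le> u" "u \<le> 1"
  shows "e2ennreal (ext_log (\<bar>a\<bar> * u)) + log_minus u + ennreal (- ln \<bar>a\<bar>)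
    = e2ennreal (- ext_log (\<bar>a\<bar> * u)) + ennreal (ln \<bar>a\<bar>)"
proof (cases "u = 0")
  case False
  then have u: "0 < u" using assms by simp
  define s t where "s = ln \<bar>a\<bar>" and "t = - ln u"
  have "t \<ge> 0" using u assms by (simp add: t_def)
  have "ennreal (s - t) + ennreal t + ennreal (- s) = ennreal (t - s) + ennreal s"
    using \<open>t \<ge> 0\<close>
    by (cases "s \<ge> 0"; cases "s \<ge> t")
       (auto simp: ennreal_neg ennreal_plus[symmetric] simp del: ennreal_plus)
  moreover have "ext_log (\<bar>a\<bar> * u) = ereal (s - t)" "log_minus u = ennreal t"
    using u assms by (simp_all add: ext_log_def ln_mult s_def t_def log_minus_eq_ln)
  ultimately show ?thesis by (simp add: s_def)
qed (use assms in \<open>auto simp: ext_log_def log_minus_def\<close>)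

context periodic_C1_map
begin

lemma C_eps_eq:
  "C_eps f \<phi> T = periodized_sup \<phi> T * (\<integral>\<^sup>+ u\<in>{0..T}. log_minus \<bar>deriv f u\<bar> \<partial>lborel)"
  unfolding C_eps_def by (simp add: abs_ext_log_eq_log_minus deriv_le_1)

lemma lyapunov_ge:
  assumes inv: "invariant_prob (\<lambda>x. a * f x) (density lborel (\<lambda>u. ennreal (\<phi> u))) \<pi>"
    and \<phi>: "(\<lambda>u. ennreal (\<phi> u)) \<in> borel_measurable borel"
    and \<nu>: "prob_space (density lborel (\<lambda>u. ennreal (\<phi> u)))"
    and a: "a \<noteq> 0" and fin: "C_eps f \<phi> T < \<infinity>"
  shows "lyapunov f a \<pi> \<ge> ereal (ln \<bar>a\<bar>) - enn2ereal (C_eps f \<phi> T)"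
proof -
  interpret \<pi>: prob_space \<pi> using inv by (simp add: invariant_prob_def)
  have sets_\<pi>[measurable_cong]: "sets \<pi> = sets borel" using inv by (simp add: invariant_prob_def)
  define U where "U = (\<integral>\<^sup>+x. e2ennreal (ext_log \<bar>a * deriv f x\<bar>) \<partial>\<pi>)"
  define N where "N = (\<integral>\<^sup>+x. e2ennreal (- ext_log \<bar>a * deriv f x\<bar>) \<partial>\<pi>)"
  define L where "L = (\<integral>\<^sup>+x. log_minus \<bar>deriv f x\<bar> \<partial>\<pi>)"
  have "L \<le> C_eps f \<phi> T"
    unfolding L_def C_eps_eq
    by (rule nn_integral_invariant_le[OF inv _ \<phi> \<nu> _ T_pos]) (auto simp: deriv_shift)
  have "U + L + ennreal (- ln \<bar>a\<bar>)
      = (\<integral>\<^sup>+x. e2ennreal (ext_log \<bar>a * deriv f x\<bar>) + log_minus \<bar>deriv f x\<bar> + ennreal (- ln \<bar>a\<bar>) \<partial>\<pi>)"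
    unfolding U_def L_def by (simp add: nn_integral_add \<pi>.emeasure_space_1)
  also have "\<dots> = (\<integral>\<^sup>+x. e2ennreal (- ext_log \<bar>a * deriv f x\<bar>) + ennreal (ln \<bar>a\<bar>) \<partial>\<pi>)"
    unfolding abs_mult by (simp add: ext_log_mult_balance a deriv_le_1)
  also have "\<dots> = N + ennreal (ln \<bar>a\<bar>)"
    unfolding N_def by (simp add: nn_integral_add \<pi>.emeasure_space_1)
  finally have balance: "U + L + ennreal (- ln \<bar>a\<bar>) = N + ennreal (ln \<bar>a\<bar>)" .
  \<comment> \<open>All three integrals are finite, so that the balance can be solved for \<open>U - N\<close> in the reals.\<close>
  have "U \<le> (\<integral>\<^sup>+x. ennreal (ln \<bar>a\<bar>) \<partial>\<pi>)"
    unfolding U_def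
  proof (intro nn_integral_mono)
    fix x
    show "e2ennreal (ext_log \<bar>a * deriv f x\<bar>) \<le> ennreal (ln \<bar>a\<bar>)"
      using a deriv_le_1[of x] mult_left_mono[OF deriv_le_1[of x], of "\<bar>a\<bar>"]
      by (auto simp: ext_log_def abs_mult e2ennreal_neg intro!: ennreal_leI ln_mono)
  qed
  then have "U < \<infinity>"
    by (simp add: \<pi>.emeasure_space_1) (metis ennreal_less_top infinity_ennreal_def le_less_trans)
  moreover have "L < \<infinity>" using \<open>L \<le> _\<close> fin by (rule le_less_trans)
  moreover have "N < \<infinity>"
    using balance calculation by (metis ennreal_add_eq_top ennreal_less_top infinity_ennreal_def less_top)
  ultimately obtain U' L' N' C' where real: "U = ennreal U'" "L = ennreal L'" "N = ennreal N'"
      "C_eps f \<phi> T = ennreal C'" "0 \<le> U'" "0 \<le> L'" "0 \<le> N'" "0 \<le> C'"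
    using fin by (metis ennreal_cases infinity_ennreal_def less_irrefl)
  have "L' \<le> C'" using \<open>L \<le> _\<close> real by simp
  have "U' + L' + max (- ln \<bar>a\<bar>) 0 = N' + max (ln \<bar>a\<bar>) 0"
  proof -
    have "ennreal (U' + L' + max (- ln \<bar>a\<bar>) 0) = ennreal (N' + max (ln \<bar>a\<bar>) 0)"
      using balance real by (simp add: ennreal_plus ennreal_max_0')
    then show ?thesis using real by (subst (asm) ennreal_inj) auto
  qed
  then have "ln \<bar>a\<bar> - C' \<le> U' - N'" using \<open>L' \<le> C'\<close> by linarith
  then show ?thesis
    unfolding lyapunov_def ext_integral_def U_def[symmetric] N_def[symmetric]
    using real by (simp add: enn2ereal_ennreal)
qed

end

section \<open>Iterated random maps\<close>

lemma forward_comp_cong: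
  assumes "\<And>t. t \<in> {1..n} \<Longrightarrow> e t = e' t"
  shows "forward_comp r e n = forward_comp r e' n"
  using assms by (induction n) (auto simp: random_map_def fun_eq_iff)

lemma measurable_forward_comp:
  assumes r[measurable]: "r \<in> borel_measurable borel"
    and h[measurable]: "h \<in> borel_measurable N"
    and E: "\<And>t. t \<in> {1..n} \<Longrightarrow> (\<lambda>w. E w t) \<in> borel_measurable N"
  shows "(\<lambda>w. forward_comp r (E w) n (h w)) \<in> borel_measurable N"
  using E
proof (induction n)
  case (Suc n)
  have [measurable]: "(\<lambda>w. E w (Suc n)) \<in> borel_measurable N"
    "(\<lambda>w. forward_comp r (E w) n (h w)) \<in> borel_measurable N"
    using Suc by auto
  show ?case by (simp add: random_map_def)
qed simp

section \<open>Independence as a product law\<close>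

lemma (in prob_space) indep_vars_reindex:
  assumes ind: "indep_vars M' X (h ` I)" and h: "inj h"
  shows "indep_vars (\<lambda>i. M' (h i)) (\<lambda>i. X (h i)) I"
proof -
  have rv: "X (h i) \<in> measurable M (M' (h i))" if "i \<in> I" for i
    using ind that by (simp add: indep_vars_def2)
  have "indep_sets (\<lambda>i. {X (h i) -` B \<inter> space M |B. B \<in> sets (M' (h i))}) I"
  proof (rule indep_setsI)
    fix A J assume J: "J \<noteq> {}" "J \<subseteq> I" "finite J"
      and A: "\<forall>j\<in>J. A j \<in> {X (h j) -` B \<inter> space M |B. B \<in> sets (M' (h j))}"
    have "prob (\<Inter>k\<in>h ` J. A (inv h k)) = (\<Prod>k\<in>h ` J. prob (A (inv h k)))"
      using J A h ind[unfolded indep_vars_def2, THEN conjunct2]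
      by (intro indep_setsD) (auto simp: inv_f_f)
    then show "prob (\<Inter>j\<in>J. A j) = (\<Prod>j\<in>J. prob (A j))"
      using h by (simp add: inv_f_f prod.reindex inj_on_subset[OF h subset_UNIV])
  qed (use rv in \<open>auto intro: measurable_sets\<close>)
  with rv show ?thesis by (simp add: indep_vars_def2)
qed

text \<open>Independence of two random variables with values in different types, in the form in which
  Fubini's theorem applies to it.\<close>

definition (in prob_space) product_law ::
    "'b measure \<Rightarrow> ('a \<Rightarrow> 'b) \<Rightarrow> 'c measure \<Rightarrow> ('a \<Rightarrow> 'c) \<Rightarrow> bool" where
  "product_law S X K Z \<longleftrightarrow> random_variable S X \<and> random_variable K Z \<and>
     distr M S X \<Otimes>\<^sub>M distr M K Z = distr M (S \<Otimes>\<^sub>M K) (\<lambda>\<omega>. (X \<omega>, Z \<omega>))"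

lemma (in prob_space) product_law_if_indep_rv:
  assumes ind: "indep_rv M S X K Z" and [measurable]: "random_variable S X" "random_variable K Z"
  shows "product_law S X K Z"
  unfolding product_law_def
proof (intro conjI assms)
  interpret X: prob_space "distr M S X" by (rule prob_space_distr) simp
  interpret Z: prob_space "distr M K Z" by (rule prob_space_distr) simp
  show "distr M S X \<Otimes>\<^sub>M distr M K Z = distr M (S \<Otimes>\<^sub>M K) (\<lambda>\<omega>. (X \<omega>, Z \<omega>))"
  proof (rule pair_measure_eqI)
    fix A B assume "A \<in> sets (distr M S X)" "B \<in> sets (distr M K Z)"
    then have AB[measurable]: "A \<in> sets S" "B \<in> sets K" by auto
    have "prob ((X -` A \<inter> space M) \<inter> (Z -` B \<inter> space M))
        = prob (X -` A \<inter> space M) * prob (Z -` B \<inter> space M)"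
      using ind unfolding indep_rv_def by (rule indep_setD) (auto intro: in_vimage_algebra)
    moreover have "(\<lambda>\<omega>. (X \<omega>, Z \<omega>)) -` (A \<times> B) \<inter> space M
        = (X -` A \<inter> space M) \<inter> (Z -` B \<inter> space M)" by auto
    ultimately show "emeasure (distr M S X) A * emeasure (distr M K Z) B
        = emeasure (distr M (S \<Otimes>\<^sub>M K) (\<lambda>\<omega>. (X \<omega>, Z \<omega>))) (A \<times> B)"
      by (simp add: emeasure_distr emeasure_eq_measure ennreal_mult)
  qed (auto intro: X.sigma_finite_measure_axioms Z.sigma_finite_measure_axioms)
qed

lemma (in prob_space) product_law_compose:
  assumes pl: "product_law S X K Z"
    and f[measurable]: "f \<in> measurable S S'" and g[measurable]: "g \<in> measurable K K'"
  shows "product_law S' (\<lambda>\<omega>. f (X \<omega>)) K' (\<lambda>\<omega>. g (Z \<omega>))"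
proof -
  have rv[measurable]: "X \<in> measurable M S" "Z \<in> measurable M K"
    and eq: "distr M S X \<Otimes>\<^sub>M distr M K Z = distr M (S \<Otimes>\<^sub>M K) (\<lambda>\<omega>. (X \<omega>, Z \<omega>))"
    using pl by (auto simp: product_law_def)
  interpret Z: prob_space "distr M K' (\<lambda>\<omega>. g (Z \<omega>))" by (rule prob_space_distr) simp
  have "distr M S' (\<lambda>\<omega>. f (X \<omega>)) \<Otimes>\<^sub>M distr M K' (\<lambda>\<omega>. g (Z \<omega>))
      = distr (distr M S X) S' f \<Otimes>\<^sub>M distr (distr M K Z) K' g"
    by (simp add: distr_distr comp_def)
  also have "\<dots> = distr (distr M S X \<Otimes>\<^sub>M distr M K Z) (S' \<Otimes>\<^sub>M K') (\<lambda>(x, z). (f x, g z))"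
    using Z.sigma_finite_measure_axioms
    by (intro pair_measure_distr) (simp_all add: distr_distr comp_def)
  also have "\<dots> = distr M (S' \<Otimes>\<^sub>M K') (\<lambda>\<omega>. (f (X \<omega>), g (Z \<omega>)))"
    unfolding eq by (simp add: distr_distr comp_def)
  finally show ?thesis by (simp add: product_law_def)
qed

lemma (in prob_space) nn_integral_product_law:
  assumes ind: "product_law S X K Z"
    and H[measurable]: "(\<lambda>(x, z). H x z) \<in> borel_measurable (S \<Otimes>\<^sub>M K)"
  shows "(\<integral>\<^sup>+\<omega>. H (X \<omega>) (Z \<omega>) \<partial>M) = (\<integral>\<^sup>+\<omega>. \<integral>\<^sup>+z. H (X \<omega>) z \<partial>distr M K Z \<partial>M)"
proof -
  have rv[measurable]: "X \<in> measurable M S" "Z \<in> measurable M K"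
    and distr: "distr M S X \<Otimes>\<^sub>M distr M K Z = distr M (S \<Otimes>\<^sub>M K) (\<lambda>\<omega>. (X \<omega>, Z \<omega>))"
    using ind by (auto simp: product_law_def)
  interpret Z: prob_space "distr M K Z" by (rule prob_space_distr) simp
  have "(\<integral>\<^sup>+\<omega>. H (X \<omega>) (Z \<omega>) \<partial>M)
      = (\<integral>\<^sup>+p. (\<lambda>(x, z). H x z) p \<partial>distr M (S \<Otimes>\<^sub>M K) (\<lambda>\<omega>. (X \<omega>, Z \<omega>)))"
    by (subst nn_integral_distr) auto
  also have "\<dots> = (\<integral>\<^sup>+p. (\<lambda>(x, z). H x z) p \<partial>(distr M S X \<Otimes>\<^sub>M distr M K Z))"
    by (simp add: distr)
  also have "\<dots> = (\<integral>\<^sup>+x. \<integral>\<^sup>+z. H x z \<partial>distr M K Z \<partial>distr M S X)"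
    by (subst Z.nn_integral_fst[symmetric]) auto
  also have "\<dots> = (\<integral>\<^sup>+\<omega>. \<integral>\<^sup>+z. H (X \<omega>) z \<partial>distr M K Z \<partial>M)"
    by (rule nn_integral_distr) auto
  finally show ?thesis .
qed

lemma (in prob_space) AE_product_lawI:
  assumes ind: "product_law S X K Z"
    and Q: "{p \<in> space (S \<Otimes>\<^sub>M K). Q (fst p) (snd p)} \<in> sets (S \<Otimes>\<^sub>M K)"
    and ae: "AE \<omega>' in M. AE \<omega> in M. Q (X \<omega>') (Z \<omega>)"
  shows "AE \<omega> in M. Q (X \<omega>) (Z \<omega>)"
proof -
  have rv[measurable]: "X \<in> measurable M S" "Z \<in> measurable M K"
    and distr: "distr M S X \<Otimes>\<^sub>M distr M K Z = distr M (S \<Otimes>\<^sub>M K) (\<lambda>\<omega>. (X \<omega>, Z \<omega>))"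
    using ind by (auto simp: product_law_def)
  interpret X: prob_space "distr M S X" by (rule prob_space_distr) simp
  interpret Z: prob_space "distr M K Z" by (rule prob_space_distr) simp
  interpret XZ: pair_sigma_finite M M ..
  have pairs: "{p \<in> space (M \<Otimes>\<^sub>M M). Q (X (fst p)) (Z (snd p))} \<in> sets (M \<Otimes>\<^sub>M M)"
  proof -
    have "(\<lambda>p. (X (fst p), Z (snd p))) -` {p \<in> space (S \<Otimes>\<^sub>M K). Q (fst p) (snd p)} \<inter> space (M \<Otimes>\<^sub>M M)
        \<in> sets (M \<Otimes>\<^sub>M M)"
      by (rule measurable_sets[OF _ Q]) measurable
    also have "(\<lambda>p. (X (fst p), Z (snd p))) -` {p \<in> space (S \<Otimes>\<^sub>M K). Q (fst p) (snd p)} \<inter> space (M \<Otimes>\<^sub>M M)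
        = {p \<in> space (M \<Otimes>\<^sub>M M). Q (X (fst p)) (Z (snd p))}"
      using rv[THEN measurable_space] by (auto simp: space_pair_measure)
    finally show ?thesis .
  qed
  then have "AE p in M \<Otimes>\<^sub>M M. Q (X (fst p)) (Z (snd p))"
    using XZ.AE_pair_iff[where P="\<lambda>x y. Q (X x) (Z y)"] ae by blast
  moreover have "distr (M \<Otimes>\<^sub>M M) (S \<Otimes>\<^sub>M K) (\<lambda>(x, y). (X x, Z y)) = distr M (S \<Otimes>\<^sub>M K) (\<lambda>\<omega>. (X \<omega>, Z \<omega>))"
    using distr by (subst pair_measure_distr[symmetric]) (auto intro: Z.sigma_finite_measure_axioms)
  moreover have "AE p in distr (M \<Otimes>\<^sub>M M) (S \<Otimes>\<^sub>M K) (\<lambda>(x, y). (X x, Z y)). Q (fst p) (snd p)"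
    using calculation(1) by (subst AE_distr_iff[OF _ Q]) (auto simp: case_prod_beta')
  ultimately have "AE p in distr M (S \<Otimes>\<^sub>M K) (\<lambda>\<omega>. (X \<omega>, Z \<omega>)). Q (fst p) (snd p)"
    by (simp only:)
  then show ?thesis using Q by (subst (asm) AE_distr_iff) auto
qed

section \<open>Escape under a negative drift\<close>

text \<open>The sum of \<open>c\<close> times the probabilities of \<open>A n\<close> telescopes against the expectations of \<open>v\<close>,
  hence is at most the initial expectation.  Staying in every \<open>A n\<close> with positive probability
  would make that sum infinite.\<close>

lemma (in prob_space) AE_eventually_leaves:
  fixes v :: "nat \<Rightarrow> 'a \<Rightarrow> ennreal" and A :: "nat \<Rightarrow> 'a set" and c :: ennreal
  assumes A: "\<And>n. A n \<in> events" and c: "c > 0"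
    and start: "(\<integral>\<^sup>+\<omega>\<in>A 0. v 0 \<omega> \<partial>M) < \<infinity>"
    and drift: "\<And>n. (\<integral>\<^sup>+\<omega>\<in>A (Suc n). v (Suc n) \<omega> \<partial>M) + c * emeasure M (A n)
      \<le> (\<integral>\<^sup>+\<omega>\<in>A n. v n \<omega> \<partial>M)"
  shows "AE \<omega> in M. \<exists>n. \<omega> \<notin> A n"
proof -
  define B where "B = (\<Inter>n. A n)"
  have B: "B \<in> events" unfolding B_def using A by auto
  have "(\<integral>\<^sup>+\<omega>\<in>A n. v n \<omega> \<partial>M) + of_nat n * (c * emeasure M B) \<le> (\<integral>\<^sup>+\<omega>\<in>A 0. v 0 \<omega> \<partial>M)" for n
  proof (induction n)
    case (Suc n)
    have "c * emeasure M B \<le> c * emeasure M (A n)"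
      using A by (intro mult_left_mono emeasure_mono) (auto simp: B_def)
    moreover have "of_nat (Suc n) * (c * emeasure M B) = c * emeasure M B + of_nat n * (c * emeasure M B)"
      by (simp add: distrib_right)
    ultimately have "(\<integral>\<^sup>+\<omega>\<in>A (Suc n). v (Suc n) \<omega> \<partial>M) + of_nat (Suc n) * (c * emeasure M B)
        \<le> ((\<integral>\<^sup>+\<omega>\<in>A (Suc n). v (Suc n) \<omega> \<partial>M) + c * emeasure M (A n)) + of_nat n * (c * emeasure M B)"
      by (auto simp only: add.assoc intro!: add_mono)
    also have "\<dots> \<le> (\<integral>\<^sup>+\<omega>\<in>A n. v n \<omega> \<partial>M) + of_nat n * (c * emeasure M B)"
      by (intro add_right_mono drift)
    finally show ?case using Suc.IH by (rule order_trans)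
  qed simp
  then have le: "of_nat n * (c * emeasure M B) \<le> (\<integral>\<^sup>+\<omega>\<in>A 0. v 0 \<omega> \<partial>M)" for n
    by (rule order_trans[OF add_increasing[OF zero_le order_refl]])
  have "c * emeasure M B = 0"
  proof (rule ccontr)
    assume "c * emeasure M B \<noteq> 0"
    then have "(SUP n. of_nat n :: ennreal) * (c * emeasure M B) = top"
      by (simp only: ennreal_SUP_of_nat_eq_top ennreal_top_mult if_False)
    moreover have "(SUP n. of_nat n :: ennreal) * (c * emeasure M B) \<le> (\<integral>\<^sup>+\<omega>\<in>A 0. v 0 \<omega> \<partial>M)"
      unfolding SUP_mult_right_ennreal by (rule SUP_least) (rule le)
    ultimately have "top \<le> (\<integral>\<^sup>+\<omega>\<in>A 0. v 0 \<omega> \<partial>M)" by simp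
    then show False using start by (simp add: top_unique)
  qed
  then have "emeasure M B = 0" using c by auto
  then have "AE \<omega> in M. \<omega> \<notin> B" using B by (intro AE_not_in) auto
  then show ?thesis by (simp add: B_def)
qed

section \<open>Independent identically distributed noise\<close>

locale iid_noise = prob_space P for P :: "'w measure" +
  fixes \<epsilon> :: "nat \<Rightarrow> 'w \<Rightarrow> real" and \<phi> :: "real \<Rightarrow> real"
  assumes indep: "indep_vars (\<lambda>_. borel) \<epsilon> {1..}"
    and density: "t \<ge> 1 \<Longrightarrow> distributed P lborel (\<epsilon> t) (\<lambda>u. ennreal (\<phi> u))"
begin

lemma noise_measurable[measurable]: "t \<ge> 1 \<Longrightarrow> \<epsilon> t \<in> borel_measurable P"
  using distributed_measurable[OF density] by simp

lemma density_measurable[measurable]: "(\<lambda>u. ennreal (\<phi> u)) \<in> borel_measurable borel"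
  using distributed_borel_measurable[OF density[of 1]] by simp

lemma distr_noise: "t \<ge> 1 \<Longrightarrow> distr P borel (\<epsilon> t) = density lborel (\<lambda>u. ennreal (\<phi> u))"
  using distributed_distr_eq_density[OF density, of t] by (simp cong: distr_cong)

lemma prob_space_density: "prob_space (density lborel (\<lambda>u. ennreal (\<phi> u)))"
  using prob_space_distr[of "\<epsilon> 1" borel] distr_noise[of 1] by simp

lemma AE_noiseI:
  assumes "t \<ge> 1" "AE e in lborel. Q e"
  shows "AE \<omega> in P. Q (\<epsilon> t \<omega>)"
proof -
  have "AE e in distr P borel (\<epsilon> t). Q e"
    unfolding distr_noise[OF assms(1)] using assms(2) by (subst AE_density) auto
  then show ?thesis by (rule AE_distrD[rotated]) (use assms in measurable)
qed

text \<open>Integrating out the next innovation given the past ones; this replaces conditional expectations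
  with respect to the natural filtration.\<close>

lemma nn_integral_next_noise:
  assumes H[measurable]: "(\<lambda>(g, e). H g e) \<in> borel_measurable (PiM {1..n} (\<lambda>_. borel) \<Otimes>\<^sub>M borel)"
  shows "(\<integral>\<^sup>+\<omega>. H (\<lambda>t\<in>{1..n}. \<epsilon> t \<omega>) (\<epsilon> (Suc n) \<omega>) \<partial>P)
    = (\<integral>\<^sup>+\<omega>. \<integral>\<^sup>+e. H (\<lambda>t\<in>{1..n}. \<epsilon> t \<omega>) e * ennreal (\<phi> e) \<partial>lborel \<partial>P)"
proof -
  have "indep_var (PiM {1..n} (\<lambda>_. borel)) (\<lambda>\<omega>. \<lambda>t\<in>{1..n}. \<epsilon> t \<omega>)
      (PiM {Suc n} (\<lambda>_. borel)) (\<lambda>\<omega>. \<lambda>t\<in>{Suc n}. \<epsilon> t \<omega>)"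
    by (rule indep_var_restrict[OF indep]) auto
  then have "product_law (PiM {1..n} (\<lambda>_. borel)) (\<lambda>\<omega>. \<lambda>t\<in>{1..n}. \<epsilon> t \<omega>)
      (PiM {Suc n} (\<lambda>_. borel)) (\<lambda>\<omega>. \<lambda>t\<in>{Suc n}. \<epsilon> t \<omega>)"
    by (simp add: product_law_def indep_var_distribution_eq)
  from product_law_compose[OF this measurable_ident, of "\<lambda>g. g (Suc n)" borel]
  have "product_law (PiM {1..n} (\<lambda>_. borel)) (\<lambda>\<omega>. \<lambda>t\<in>{1..n}. \<epsilon> t \<omega>) borel (\<epsilon> (Suc n))"
    by (simp add: measurable_component_singleton)
  from nn_integral_product_law[OF this H]
  have "(\<integral>\<^sup>+\<omega>. H (\<lambda>t\<in>{1..n}. \<epsilon> t \<omega>) (\<epsilon> (Suc n) \<omega>) \<partial>P)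
      = (\<integral>\<^sup>+\<omega>. \<integral>\<^sup>+e. H (\<lambda>t\<in>{1..n}. \<epsilon> t \<omega>) e \<partial>density lborel (\<lambda>u. ennreal (\<phi> u)) \<partial>P)"
    by (simp only: distr_noise[OF le_add1[of 1 n, unfolded plus_1_eq_Suc]])
  also have "\<dots> = (\<integral>\<^sup>+\<omega>. \<integral>\<^sup>+e. H (\<lambda>t\<in>{1..n}. \<epsilon> t \<omega>) e * ennreal (\<phi> e) \<partial>lborel \<partial>P)"
  proof (rule nn_integral_cong)
    fix \<omega> assume "\<omega> \<in> space P"
    have [measurable]: "H (\<lambda>t\<in>{1..n}. \<epsilon> t \<omega>) \<in> borel_measurable borel"
      using measurable_compose[OF measurable_Pair1' H, of "\<lambda>t\<in>{1..n}. \<epsilon> t \<omega>"]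
      by (simp add: space_PiM del: One_nat_def)
    show "(\<integral>\<^sup>+e. H (\<lambda>t\<in>{1..n}. \<epsilon> t \<omega>) e \<partial>density lborel (\<lambda>u. ennreal (\<phi> u)))
        = (\<integral>\<^sup>+e. H (\<lambda>t\<in>{1..n}. \<epsilon> t \<omega>) e * ennreal (\<phi> e) \<partial>lborel)"
      by (subst nn_integral_density) (simp_all add: mult.commute del: One_nat_def)
  qed
  finally show ?thesis .
qed

lemma iid_noise_shift: "iid_noise P (\<lambda>t. \<epsilon> (Suc t)) \<phi>"
proof
  have "indep_vars (\<lambda>_. borel) \<epsilon> (Suc ` {1..})"
    by (rule indep_vars_subset[OF indep]) auto
  then show "indep_vars (\<lambda>_. borel) (\<lambda>t. \<epsilon> (Suc t)) {1..}"
    using indep_vars_reindex[where h=Suc and M'="\<lambda>_. borel" and X=\<epsilon> and I="{1..}"] by simp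
qed (use density in auto)

lemma product_law_first_rest:
  "product_law borel (\<epsilon> 1) noise_space (\<lambda>\<omega>. noise_seq (\<lambda>t. \<epsilon> (Suc t)) \<omega>)"
proof -
  have "indep_var (PiM {1} (\<lambda>_. borel)) (\<lambda>\<omega>. \<lambda>t\<in>{1}. \<epsilon> t \<omega>)
      (PiM {2..} (\<lambda>_. borel)) (\<lambda>\<omega>. \<lambda>t\<in>{2..}. \<epsilon> t \<omega>)"
    by (rule indep_var_restrict[OF indep]) auto
  then have *: "product_law (PiM {1} (\<lambda>_. borel)) (\<lambda>\<omega>. \<lambda>t\<in>{1}. \<epsilon> t \<omega>)
      (PiM {2..} (\<lambda>_. borel)) (\<lambda>\<omega>. \<lambda>t\<in>{2..}. \<epsilon> t \<omega>)"
    by (simp add: product_law_def indep_var_distribution_eq)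
  have "(\<lambda>g. g 1) \<in> measurable (PiM {1::nat} (\<lambda>_. borel)) (borel :: real measure)"
    "(\<lambda>g. \<lambda>t\<in>{1..}. g (Suc t)) \<in> measurable (PiM {2..} (\<lambda>_. borel :: real measure)) noise_space"
    by (auto intro!: measurable_restrict measurable_component_singleton)
  from product_law_compose[OF * this] show ?thesis
    by (simp add: restrict_def cong: if_cong)
qed

end

section \<open>Recurrent separation of orbits\<close>

text \<open>The negation of \<open>\<bar>D\<^sub>n\<bar> \<le> \<delta>\<close> for all large \<open>n\<close>.  For \<open>\<delta> > 0\<close> it is stronger than the
  failure of \<open>D\<^sub>n \<longlonglongrightarrow> 0\<close> and visibly measurable.\<close>

definition recurrently_separated ::
    "(real \<Rightarrow> real) \<Rightarrow> real \<Rightarrow> (nat \<Rightarrow> real) \<Rightarrow> real \<Rightarrow> real \<Rightarrow> bool" where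
  "recurrently_separated r \<delta> e x y \<longleftrightarrow>
     (\<forall>m. \<exists>n\<ge>m. \<delta> < \<bar>forward_comp r e n x - forward_comp r e n y\<bar>)"

lemma recurrently_separated_cong:
  assumes "\<And>t. t \<ge> 1 \<Longrightarrow> e t = e' t"
  shows "recurrently_separated r \<delta> e x y \<longleftrightarrow> recurrently_separated r \<delta> e' x y"
  using forward_comp_cong[of _ e e' r] assms by (simp add: recurrently_separated_def)

lemma recurrently_separated_sym:
  "recurrently_separated r \<delta> e x y \<longleftrightarrow> recurrently_separated r \<delta> e y x"
  by (simp add: recurrently_separated_def abs_minus_commute)

lemma recurrently_separated_not_tendsto:
  assumes "recurrently_separated r \<delta> e x y" "\<delta> > 0"
  shows "\<not> (\<lambda>n. forward_comp r e n x - forward_comp r e n y) \<longlonglongrightarrow> 0"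
proof
  assume "(\<lambda>n. forward_comp r e n x - forward_comp r e n y) \<longlonglongrightarrow> 0"
  then obtain m where "\<And>n. n \<ge> m \<Longrightarrow> \<bar>forward_comp r e n x - forward_comp r e n y\<bar> < \<delta>"
    using LIMSEQ_D[OF _ assms(2)] by fastforce
  then show False using assms(1) by (meson less_asym recurrently_separated_def)
qed

lemma sets_recurrently_separated:
  assumes [measurable]: "r \<in> borel_measurable borel" "h \<in> borel_measurable N" "k \<in> borel_measurable N"
    and E: "\<And>t. t \<ge> 1 \<Longrightarrow> (\<lambda>w. E w t) \<in> borel_measurable N"
  shows "{w \<in> space N. recurrently_separated r \<delta> (E w) (h w) (k w)} \<in> sets N"
proof -
  have [measurable]: "(\<lambda>w. forward_comp r (E w) n (h w)) \<in> borel_measurable N"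
    "(\<lambda>w. forward_comp r (E w) n (k w)) \<in> borel_measurable N" for n
    using E by (auto intro!: measurable_forward_comp)
  show ?thesis unfolding recurrently_separated_def by measurable
qed

context iid_noise
begin

text \<open>While the distance is at most \<open>\<delta>\<close>, \<open>V\<close> decreases by at least \<open>c\<close> on average, so the stay near
  the diagonal ends almost surely.  The value \<open>V 0\<close> may be infinite, hence the restriction to
  orbits that never meet.\<close>

lemma AE_drift_separates:
  fixes V :: "real \<Rightarrow> ennreal" and x y :: real
  assumes r[measurable]: "r \<in> borel_measurable borel" and V[measurable]: "V \<in> borel_measurable borel"
    and V_fin: "\<And>d. d \<noteq> 0 \<Longrightarrow> V d < \<infinity>" and c: "c > 0"
    and drift: "\<And>p q. \<bar>p - q\<bar> \<le> \<delta> \<Longrightarrow>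
      (\<integral>\<^sup>+e. V (r (p + e) - r (q + e)) * ennreal (\<phi> e) \<partial>lborel) + c \<le> V (p - q)"
  shows "AE \<omega> in P. (\<forall>n. forward_comp r (\<lambda>t. \<epsilon> t \<omega>) n x \<noteq> forward_comp r (\<lambda>t. \<epsilon> t \<omega>) n y) \<longrightarrow>
      recurrently_separated r \<delta> (\<lambda>t. \<epsilon> t \<omega>) x y"
proof -
  \<comment> \<open>\<open>\<Delta> e n\<close> is the difference of the orbits at time \<open>n + 1\<close>: the innovation at that time cancels.
    It is thus a function of the first \<open>n\<close> innovations, and \<open>\<Delta> e (Suc n)\<close> depends on
    innovation \<open>Suc n\<close> through \<open>X_Suc\<close>.\<close>
  define X Y where "X e n = r (forward_comp r e n x)" and "Y e n = r (forward_comp r e n y)"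
    for e :: "nat \<Rightarrow> real" and n
  define \<Delta> where "\<Delta> e n = X e n - Y e n" for e n
  \<comment> \<open>Truncating \<open>V\<close> at time \<open>m\<close> by \<open>K\<close> makes the initial expectation finite; the union over \<open>K\<close>
    covers all noise sequences for which the orbits differ at time \<open>m + 1\<close>.\<close>
  define A where "A m K n = {\<omega> \<in> space P. V (\<Delta> (\<lambda>t. \<epsilon> t \<omega>) m) \<le> of_nat K
      \<and> (\<forall>k\<in>{m..m + n}. \<bar>\<Delta> (\<lambda>t. \<epsilon> t \<omega>) k\<bar> \<le> \<delta>)}" for m K n :: nat
  have XY_cong: "X e n = X e' n" "Y e n = Y e' n" "\<Delta> e n = \<Delta> e' n"
    if "\<And>t. t \<in> {1..n} \<Longrightarrow> e t = e' t" for e e' n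
    using forward_comp_cong[of n e e' r] that by (auto simp: X_def Y_def \<Delta>_def)
  have X_Suc: "X e (Suc n) = r (X e n + e (Suc n))" "Y e (Suc n) = r (Y e n + e (Suc n))" for e n
    by (simp_all add: X_def Y_def random_map_def)
  have XY_meas: "(\<lambda>w. X (E w) n) \<in> borel_measurable N" "(\<lambda>w. Y (E w) n) \<in> borel_measurable N"
      "(\<lambda>w. \<Delta> (E w) n) \<in> borel_measurable N"
    if E: "\<And>t. t \<in> {1..n} \<Longrightarrow> (\<lambda>w. E w t) \<in> borel_measurable N"
    for E :: "_ \<Rightarrow> nat \<Rightarrow> real" and n and N
    using measurable_forward_comp[OF r _ E, of "\<lambda>_. x"] measurable_forward_comp[OF r _ E, of "\<lambda>_. y"]
    by (auto simp: X_def Y_def \<Delta>_def)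
  have \<Delta>_meas[measurable]: "(\<lambda>\<omega>. \<Delta> (\<lambda>t. \<epsilon> t \<omega>) n) \<in> borel_measurable P" for n
    by (rule XY_meas) auto
  have A_sets[measurable]: "A m K n \<in> events" for m K n
    unfolding A_def by measurable
  have leaves: "AE \<omega> in P. \<exists>n. \<omega> \<notin> A m K n" for m K
  proof (rule AE_eventually_leaves[where v="\<lambda>n \<omega>. V (\<Delta> (\<lambda>t. \<epsilon> t \<omega>) (m + n))", OF A_sets c])
    have "(\<integral>\<^sup>+\<omega>\<in>A m K 0. V (\<Delta> (\<lambda>t. \<epsilon> t \<omega>) (m + 0)) \<partial>P) \<le> (\<integral>\<^sup>+\<omega>. of_nat K \<partial>P)"
      by (intro nn_integral_mono) (auto simp: A_def indicator_def)
    also have "\<dots> < \<infinity>" by (simp add: emeasure_space_1 of_nat_less_top)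
    finally show "(\<integral>\<^sup>+\<omega>\<in>A m K 0. V (\<Delta> (\<lambda>t. \<epsilon> t \<omega>) (m + 0)) \<partial>P) < \<infinity>" .
  next
    fix n
    define N where "N = m + n"
    define S where "S \<omega> = (\<lambda>t\<in>{1..N}. \<epsilon> t \<omega>)" for \<omega>
    define Q where "Q = PiM {1..N} (\<lambda>_. borel :: real measure)"
    \<comment> \<open>\<open>G\<close> is the event \<open>A m K n\<close> seen as a set of the first \<open>N\<close> innovations.\<close>
    define G where "G = {g \<in> space Q. V (\<Delta> g m) \<le> of_nat K \<and> (\<forall>k\<in>{m..N}. \<bar>\<Delta> g k\<bar> \<le> \<delta>)}"
    have comp: "(\<lambda>g. g t) \<in> borel_measurable Q" if "t \<in> {1..k}" "k \<le> N" for t k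
      using that unfolding Q_def by (intro measurable_component_singleton) auto
    have [measurable]: "(\<lambda>g. X g N) \<in> borel_measurable Q" "(\<lambda>g. Y g N) \<in> borel_measurable Q"
      by (rule XY_meas, rule comp, auto)+
    have \<Delta>_Q[measurable (raw)]: "(\<lambda>g. \<Delta> g k) \<in> borel_measurable Q" if "k \<le> N" for k
      using that by (intro XY_meas comp) auto
    have [measurable]: "G \<in> sets Q"
    proof -
      have [measurable]: "(\<lambda>g. \<Delta> g m) \<in> borel_measurable Q" by (rule \<Delta>_Q) (simp add: N_def)
      have "{g \<in> space Q. \<bar>\<Delta> g k\<bar> \<le> \<delta>} \<in> sets Q" if "k \<in> {m..N}" for k
      proof -
        have [measurable]: "(\<lambda>g. \<Delta> g k) \<in> borel_measurable Q" using that by (intro \<Delta>_Q) simp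
        show ?thesis by measurable
      qed
      then have "{g \<in> space Q. \<forall>k\<in>{m..N}. \<bar>\<Delta> g k\<bar> \<le> \<delta>} \<in> sets Q"
        by (intro sets.sets_Collect_finite_All') (auto simp: N_def)
      moreover have "{g \<in> space Q. V (\<Delta> g m) \<le> of_nat K} \<in> sets Q" by measurable
      ultimately show ?thesis unfolding G_def by (intro sets.sets_Collect_conj)
    qed
    have S_meas[measurable]: "S \<in> measurable P Q"
      unfolding S_def Q_def by (intro measurable_restrict) auto
    have \<Delta>_S: "\<Delta> (S \<omega>) k = \<Delta> (\<lambda>t. \<epsilon> t \<omega>) k" if "k \<le> N" for \<omega> k
      using that by (intro XY_cong) (auto simp: S_def)
    have ind: "indicator (A m K n) \<omega> = (indicator G (S \<omega>) :: ennreal)" if "\<omega> \<in> space P" for \<omega>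
      using that measurable_space[OF S_meas that] \<Delta>_S by (auto simp: A_def G_def indicator_def N_def)
    define W where "W \<omega> = (\<integral>\<^sup>+e. V (r (X (S \<omega>) N + e) - r (Y (S \<omega>) N + e)) * ennreal (\<phi> e) \<partial>lborel)" for \<omega>
    have [measurable]: "W \<in> borel_measurable P" unfolding W_def by measurable
    have "(\<integral>\<^sup>+\<omega>\<in>A m K (Suc n). V (\<Delta> (\<lambda>t. \<epsilon> t \<omega>) (m + Suc n)) \<partial>P)
        \<le> (\<integral>\<^sup>+\<omega>. V (r (X (S \<omega>) N + \<epsilon> (Suc N) \<omega>) - r (Y (S \<omega>) N + \<epsilon> (Suc N) \<omega>)) * indicator G (S \<omega>) \<partial>P)"
    proof (rule nn_integral_mono)
      fix \<omega> assume \<omega>: "\<omega> \<in> space P"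
      have "X (S \<omega>) N = X (\<lambda>t. \<epsilon> t \<omega>) N" "Y (S \<omega>) N = Y (\<lambda>t. \<epsilon> t \<omega>) N"
        by (intro XY_cong; simp add: S_def)+
      then have "\<Delta> (\<lambda>t. \<epsilon> t \<omega>) (m + Suc n)
          = r (X (S \<omega>) N + \<epsilon> (Suc N) \<omega>) - r (Y (S \<omega>) N + \<epsilon> (Suc N) \<omega>)"
        by (simp add: \<Delta>_def X_Suc N_def)
      moreover have "indicator (A m K (Suc n)) \<omega> \<le> (indicator (A m K n) \<omega> :: ennreal)"
        by (auto simp: A_def indicator_def)
      ultimately show "V (\<Delta> (\<lambda>t. \<epsilon> t \<omega>) (m + Suc n)) * indicator (A m K (Suc n)) \<omega>
          \<le> V (r (X (S \<omega>) N + \<epsilon> (Suc N) \<omega>) - r (Y (S \<omega>) N + \<epsilon> (Suc N) \<omega>)) * indicator G (S \<omega>)"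
        by (simp add: ind[OF \<omega>, symmetric] mult_left_mono)
    qed
    also have "\<dots> = (\<integral>\<^sup>+\<omega>. \<integral>\<^sup>+e. V (r (X (S \<omega>) N + e) - r (Y (S \<omega>) N + e)) * indicator G (S \<omega>)
        * ennreal (\<phi> e) \<partial>lborel \<partial>P)"
      unfolding S_def
      by (rule nn_integral_next_noise, unfold Q_def[symmetric]) measurable
    also have "\<dots> = (\<integral>\<^sup>+\<omega>. W \<omega> * indicator (A m K n) \<omega> \<partial>P)"
    proof (rule nn_integral_cong)
      fix \<omega> assume "\<omega> \<in> space P"
      then show "(\<integral>\<^sup>+e. V (r (X (S \<omega>) N + e) - r (Y (S \<omega>) N + e)) * indicator G (S \<omega>)
          * ennreal (\<phi> e) \<partial>lborel) = W \<omega> * indicator (A m K n) \<omega>"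
        by (simp add: ind W_def mult.assoc mult.commute[of "indicator _ _ :: ennreal"]
            nn_integral_multc[symmetric])
    qed
    finally have "(\<integral>\<^sup>+\<omega>\<in>A m K (Suc n). V (\<Delta> (\<lambda>t. \<epsilon> t \<omega>) (m + Suc n)) \<partial>P) + c * emeasure P (A m K n)
        \<le> (\<integral>\<^sup>+\<omega>. W \<omega> * indicator (A m K n) \<omega> \<partial>P) + (\<integral>\<^sup>+\<omega>. c * indicator (A m K n) \<omega> \<partial>P)"
      by (simp add: nn_integral_cmult_indicator add_right_mono)
    also have "\<dots> = (\<integral>\<^sup>+\<omega>. (W \<omega> + c) * indicator (A m K n) \<omega> \<partial>P)"
      by (subst nn_integral_add[symmetric]) (auto simp: distrib_right)
    also have "\<dots> \<le> (\<integral>\<^sup>+\<omega>\<in>A m K n. V (\<Delta> (\<lambda>t. \<epsilon> t \<omega>) (m + n)) \<partial>P)"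
    proof (rule nn_integral_mono)
      fix \<omega> assume "\<omega> \<in> space P"
      show "(W \<omega> + c) * indicator (A m K n) \<omega>
          \<le> V (\<Delta> (\<lambda>t. \<epsilon> t \<omega>) (m + n)) * indicator (A m K n) \<omega>"
      proof (cases "\<omega> \<in> A m K n")
        case True
        then have "\<bar>\<Delta> (S \<omega>) N\<bar> \<le> \<delta>" by (simp add: A_def \<Delta>_S N_def)
        then have "W \<omega> + c \<le> V (\<Delta> (S \<omega>) N)" unfolding W_def \<Delta>_def by (rule drift)
        then show ?thesis using True by (simp add: \<Delta>_S N_def)
      qed simp
    qed
    finally show "(\<integral>\<^sup>+\<omega>\<in>A m K (Suc n). V (\<Delta> (\<lambda>t. \<epsilon> t \<omega>) (m + Suc n)) \<partial>P) + c * emeasure P (A m K n)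
        \<le> (\<integral>\<^sup>+\<omega>\<in>A m K n. V (\<Delta> (\<lambda>t. \<epsilon> t \<omega>) (m + n)) \<partial>P)" .
  qed
  have "AE \<omega> in P. \<forall>m K. \<exists>n. \<omega> \<notin> A m K n"
    using leaves by (simp add: AE_all_countable)
  then show ?thesis
  proof (rule AE_mp[OF _ AE_I2], intro impI)
    fix \<omega> assume \<omega>: "\<omega> \<in> space P" and out: "\<forall>m K. \<exists>n. \<omega> \<notin> A m K n"
      and ne: "\<forall>n. forward_comp r (\<lambda>t. \<epsilon> t \<omega>) n x \<noteq> forward_comp r (\<lambda>t. \<epsilon> t \<omega>) n y"
    have \<Delta>_eq: "\<Delta> (\<lambda>t. \<epsilon> t \<omega>) n
        = forward_comp r (\<lambda>t. \<epsilon> t \<omega>) (Suc n) x - forward_comp r (\<lambda>t. \<epsilon> t \<omega>) (Suc n) y" for n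
      by (simp add: \<Delta>_def X_def Y_def random_map_def)
    show "recurrently_separated r \<delta> (\<lambda>t. \<epsilon> t \<omega>) x y"
      unfolding recurrently_separated_def
    proof (rule ccontr)
      assume "\<not> (\<forall>m. \<exists>n\<ge>m. \<delta> < \<bar>forward_comp r (\<lambda>t. \<epsilon> t \<omega>) n x - forward_comp r (\<lambda>t. \<epsilon> t \<omega>) n y\<bar>)"
      then obtain m where m: "\<And>n. n \<ge> m \<Longrightarrow>
          \<bar>forward_comp r (\<lambda>t. \<epsilon> t \<omega>) n x - forward_comp r (\<lambda>t. \<epsilon> t \<omega>) n y\<bar> \<le> \<delta>"
        by (meson not_le)
      have "V (\<Delta> (\<lambda>t. \<epsilon> t \<omega>) m) < \<infinity>"
        using ne[rule_format, of "Suc m"] unfolding \<Delta>_eq by (intro V_fin) (simp only: right_minus_eq not_False_eq_True)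
      then obtain K where "V (\<Delta> (\<lambda>t. \<epsilon> t \<omega>) m) < of_nat K"
        using ennreal_Ex_less_of_nat by auto
      moreover have "\<bar>\<Delta> (\<lambda>t. \<epsilon> t \<omega>) k\<bar> \<le> \<delta>" if "k \<ge> m" for k
        unfolding \<Delta>_eq using that by (intro m) simp
      ultimately have "\<omega> \<in> A m K n" for n
        using \<omega> by (auto simp: A_def intro: less_imp_le)
      then show False using out by blast
    qed
  qed
qed

text \<open>For a fixed noise sequence and a fixed second point, the first points that are mapped to the
  same value at time \<open>n\<close> form a null set.\<close>

lemma AE_orbits_distinct:
  assumes r[measurable]: "r \<in> borel_measurable borel"
    and null: "\<And>N. negligible N \<Longrightarrow> negligible {x. r x \<in> N}"
  shows "AE z in (lborel :: (real \<times> real) measure). AE \<omega> in P. \<forall>n.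
    forward_comp r (\<lambda>t. \<epsilon> t \<omega>) n (fst z) \<noteq> forward_comp r (\<lambda>t. \<epsilon> t \<omega>) n (snd z)"
proof -
  interpret L: pair_sigma_finite P "lborel :: (real \<times> real) measure" ..
  have [measurable]: "(\<lambda>p. forward_comp r (\<lambda>t. \<epsilon> t (fst p)) n (fst (snd p)))
      \<in> borel_measurable (P \<Otimes>\<^sub>M (lborel :: (real \<times> real) measure))"
    "(\<lambda>p. forward_comp r (\<lambda>t. \<epsilon> t (fst p)) n (snd (snd p)))
      \<in> borel_measurable (P \<Otimes>\<^sub>M (lborel :: (real \<times> real) measure))" for n
    by (auto intro!: measurable_forward_comp r measurable_compose[OF measurable_snd]
        borel_measurable_continuous_onI continuous_intros)
  have "AE z in lborel. \<forall>n. forward_comp r e n (fst z) \<noteq> forward_comp r e n (snd z)"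
    for e :: "nat \<Rightarrow> real"
  proof -
    have [measurable]: "(\<lambda>w. forward_comp r e n w) \<in> borel_measurable borel" for n
      by (intro measurable_forward_comp r) auto
    have "AE v in lborel. forward_comp r e n u \<noteq> forward_comp r e n v" for n u
    proof -
      have "negligible {v. forward_comp r e n v \<in> {forward_comp r e n u}}"
        by (intro negligible_forward_comp_vimage null) auto
      then have "AE v in lebesgue. forward_comp r e n u \<noteq> forward_comp r e n v"
        by (intro AE_I'[of "{v. forward_comp r e n v \<in> {forward_comp r e n u}}"])
           (auto simp: negligible_iff_null_sets)
      then show ?thesis by (simp add: AE_completion_iff)
    qed
    then have "AE u in lborel. AE v in lborel. \<forall>n. forward_comp r e n (fst (u, v)) \<noteq> forward_comp r e n (snd (u, v))"
      by (simp add: AE_all_countable)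
    then have "AE z in lborel \<Otimes>\<^sub>M lborel. \<forall>n. forward_comp r e n (fst z) \<noteq> forward_comp r e n (snd z)"
      by (rule lborel_pair.AE_pair_measure[rotated]) measurable
    then show ?thesis unfolding lborel_prod .
  qed
  then have "AE \<omega> in P. AE z in (lborel :: (real \<times> real) measure).
      \<forall>n. forward_comp r (\<lambda>t. \<epsilon> t \<omega>) n (fst z) \<noteq> forward_comp r (\<lambda>t. \<epsilon> t \<omega>) n (snd z)"
    by simp
  then show ?thesis by (rule L.AE_commute[THEN iffD1, rotated]) measurable
qed

end

section \<open>The drift of the logarithmic distance\<close>

context periodic_C1_map
begin

text \<open>For \<open>p = q\<close> the right-hand side is infinite.  Otherwise integrate \<open>log_minus_scaled_eq\<close>; the
  logarithm of the difference quotient over the fixed step \<open>p - q\<close> is a periodic function of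
  \<open>q + e\<close>.\<close>

lemma log_distance_drift:
  fixes \<phi> :: "real \<Rightarrow> real"
  assumes \<phi>[measurable]: "(\<lambda>u. ennreal (\<phi> u)) \<in> borel_measurable borel"
    and \<nu>: "prob_space (density lborel (\<lambda>u. ennreal (\<phi> u)))"
    and a: "\<bar>a\<bar> \<ge> 1" and pq: "\<bar>p - q\<bar> \<le> \<delta>"
    and L: "\<And>d. 0 < \<bar>d\<bar> \<Longrightarrow> \<bar>d\<bar> \<le> \<delta> \<Longrightarrow>
      (\<integral>\<^sup>+u\<in>{0..T}. log_minus (\<bar>f (u + d) - f u\<bar> / \<bar>d\<bar>) \<partial>lborel) \<le> L"
  shows "(\<integral>\<^sup>+e. log_minus (\<bar>a * f (p + e) - a * f (q + e)\<bar> / (\<delta> * \<bar>a\<bar>)) * ennreal (\<phi> e) \<partial>lborel)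
      + ennreal (ln \<bar>a\<bar>)
    \<le> log_minus (\<bar>p - q\<bar> / (\<delta> * \<bar>a\<bar>)) + periodized_sup \<phi> T * L"
proof (cases "p = q")
  case True
  then show ?thesis by (simp add: log_minus_def)
next
  case False
  define d where "d = p - q"
  have d: "0 < \<bar>d\<bar>" "\<bar>d\<bar> \<le> \<delta>" and p: "p = q + d" using False pq by (auto simp: d_def)
  define V where "V = log_minus (\<bar>d\<bar> / (\<delta> * \<bar>a\<bar>))"
  define quot where "quot u = log_minus (\<bar>f (u + d) - f u\<bar> / \<bar>d\<bar>)" for u
  have [measurable]: "quot \<in> borel_measurable borel" unfolding quot_def by measurable
  interpret \<nu>: prob_space "density lborel (\<lambda>u. ennreal (\<phi> u))" by fact
  have mass: "(\<integral>\<^sup>+e. ennreal (\<phi> e) \<partial>lborel) = 1"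
    using \<nu>.emeasure_space_1 by (simp add: emeasure_density)
  have "(\<integral>\<^sup>+e. log_minus (\<bar>a * f (p + e) - a * f (q + e)\<bar> / (\<delta> * \<bar>a\<bar>)) * ennreal (\<phi> e) \<partial>lborel)
      + ennreal (ln \<bar>a\<bar>)
    = (\<integral>\<^sup>+e. log_minus (\<bar>a * f (p + e) - a * f (q + e)\<bar> / (\<delta> * \<bar>a\<bar>)) * ennreal (\<phi> e)
        + ennreal (ln \<bar>a\<bar>) * ennreal (\<phi> e) \<partial>lborel)"
    by (subst nn_integral_add) (auto simp: nn_integral_cmult mass)
  also have "\<dots> = (\<integral>\<^sup>+e. V * ennreal (\<phi> e) + quot (q + e) * ennreal (\<phi> e) \<partial>lborel)"
  proof (rule nn_integral_cong)
    fix e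
    have "log_minus (\<bar>a * (f (q + e + d) - f (q + e))\<bar> / (\<delta> * \<bar>a\<bar>)) + ennreal (ln \<bar>a\<bar>) = V + quot (q + e)"
      unfolding V_def quot_def by (rule log_minus_scaled_eq[OF a d lipschitz])
    moreover have "a * f (p + e) - a * f (q + e) = a * (f (q + e + d) - f (q + e))"
      by (simp add: p algebra_simps)
    ultimately show "log_minus (\<bar>a * f (p + e) - a * f (q + e)\<bar> / (\<delta> * \<bar>a\<bar>)) * ennreal (\<phi> e)
        + ennreal (ln \<bar>a\<bar>) * ennreal (\<phi> e) = V * ennreal (\<phi> e) + quot (q + e) * ennreal (\<phi> e)"
      by (simp only: distrib_right[symmetric])
  qed
  also have "\<dots> = V + (\<integral>\<^sup>+e. quot (q + e) * ennreal (\<phi> e) \<partial>lborel)"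
    by (subst nn_integral_add) (auto simp: nn_integral_cmult mass)
  also have "\<dots> \<le> V + periodized_sup \<phi> T * (\<integral>\<^sup>+u\<in>{0..T}. quot u \<partial>lborel)"
  proof (intro add_left_mono nn_integral_periodic_le)
    fix u show "quot (u + T) = quot u"
      using periodic[of "u + d"] periodic[of u] by (simp add: quot_def add.assoc add.commute[of T])
  qed (use T_pos in measurable)
  also have "\<dots> \<le> V + periodized_sup \<phi> T * L"
    unfolding quot_def by (intro add_left_mono mult_left_mono L d) simp
  finally show ?thesis by (simp add: V_def d_def)
qed

end

section \<open>Chains that differ in one innovation\<close>

lemma AE_lborel_translate:
  fixes c :: "'a :: euclidean_space"
  assumes "AE x in lborel. Q x"
  shows "AE u in lborel. Q (c + u)"
proof -
  have "AE x in distr lborel borel ((+) c). Q x" unfolding lborel_distr_plus by (rule assms)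
  then show ?thesis by (rule AE_distrD[rotated]) simp
qed

lemma chain_Suc_eq_forward_comp:
  "chain r x e (Suc n) = forward_comp r (\<lambda>t. e (Suc t)) n (r x + e 1)"
  by (induction n) (simp_all add: random_map_def)

text \<open>From time 1 on, both chains are driven by the same shifted noise, so that their difference is
  that of two orbits of the same random maps.\<close>

lemma chain_diff_Suc:
  "chain_diff r x e e1 (Suc n) = forward_comp r (\<lambda>t. e (Suc t)) n (r x + e 1)
     - forward_comp r (\<lambda>t. e (Suc t)) n (r x + e1)"
proof -
  have "forward_comp r (\<lambda>t. (e(1 := e1)) (Suc t)) n = forward_comp r (\<lambda>t. e (Suc t)) n"
    by (rule forward_comp_cong) auto
  then show ?thesis unfolding chain_diff_def chain_Suc_eq_forward_comp by simp
qed

context iid_noise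
begin

lemma noise_seq_measurable: "noise_seq \<epsilon> \<in> measurable P noise_space"
  by (intro measurable_restrict) auto

lemma AE_recurrently_separated:
  fixes V :: "real \<Rightarrow> ennreal"
  assumes r: "r \<in> borel_measurable borel" and V: "V \<in> borel_measurable borel"
    and V_fin: "\<And>d. d \<noteq> 0 \<Longrightarrow> V d < \<infinity>" and c: "c > 0"
    and drift: "\<And>p q. \<bar>p - q\<bar> \<le> \<delta> \<Longrightarrow>
      (\<integral>\<^sup>+e. V (r (p + e) - r (q + e)) * ennreal (\<phi> e) \<partial>lborel) + c \<le> V (p - q)"
    and null: "\<And>N. negligible N \<Longrightarrow> negligible {x. r x \<in> N}"
  shows "AE z in (lborel :: (real \<times> real) measure). AE \<omega> in P.
    recurrently_separated r \<delta> (\<lambda>t. \<epsilon> t \<omega>) (fst z) (snd z)"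
proof (rule AE_mp[OF AE_orbits_distinct[OF r] AE_I2], fact null, intro impI)
  fix z :: "real \<times> real"
  assume "AE \<omega> in P. \<forall>n. forward_comp r (\<lambda>t. \<epsilon> t \<omega>) n (fst z) \<noteq> forward_comp r (\<lambda>t. \<epsilon> t \<omega>) n (snd z)"
  moreover have "AE \<omega> in P.
      (\<forall>n. forward_comp r (\<lambda>t. \<epsilon> t \<omega>) n (fst z) \<noteq> forward_comp r (\<lambda>t. \<epsilon> t \<omega>) n (snd z)) \<longrightarrow>
      recurrently_separated r \<delta> (\<lambda>t. \<epsilon> t \<omega>) (fst z) (snd z)"
    by (rule AE_drift_separates[OF r V _ c]) (use V_fin drift in auto)
  ultimately show "AE \<omega> in P. recurrently_separated r \<delta> (\<lambda>t. \<epsilon> t \<omega>) (fst z) (snd z)"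
    by eventually_elim auto
qed

text \<open>By independence it suffices to fix the replaced innovation, then the initial state, then
  \<open>\<epsilon> 1\<close>, and to exclude a null set at each stage.  The exceptional second coordinates form a null set
  \<open>B\<close>; for every initial state \<open>x\<close> the replaced innovation avoids \<open>B - r x\<close> almost surely,
  because its law has a density.\<close>

lemma AE_chain_diff_separated:
  fixes X0 \<epsilon>1' :: "'w \<Rightarrow> real"
  assumes r[measurable]: "r \<in> borel_measurable borel"
    and sep: "AE z in (lborel :: (real \<times> real) measure). AE \<omega> in P.
      recurrently_separated r \<delta> (\<lambda>t. \<epsilon> (Suc t) \<omega>) (fst z) (snd z)"
    and X0[measurable]: "X0 \<in> borel_measurable P"
    and X0_noise: "indep_rv P borel X0 noise_space (noise_seq \<epsilon>)"
    and \<epsilon>1'[measurable]: "\<epsilon>1' \<in> borel_measurable P"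
    and \<epsilon>1'_distr: "distr P borel \<epsilon>1' = distr P borel (\<epsilon> 1)"
    and \<epsilon>1'_indep: "indep_rv P borel \<epsilon>1' (borel \<Otimes>\<^sub>M noise_space) (\<lambda>\<omega>. (X0 \<omega>, noise_seq \<epsilon> \<omega>))"
  shows "AE \<omega> in P. recurrently_separated r \<delta> (\<lambda>t. \<epsilon> (Suc t) \<omega>)
    (r (X0 \<omega>) + \<epsilon> 1 \<omega>) (r (X0 \<omega>) + \<epsilon>1' \<omega>)"
proof -
  interpret PP: pair_sigma_finite P P ..
  note [measurable] = noise_seq_measurable
  define R where "R x e e1 \<longleftrightarrow>
      recurrently_separated r \<delta> (\<lambda>t. e (Suc t)) (r x + e 1) (r x + e1)" for x e1 and e :: "nat \<Rightarrow> real"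
  have R_noise: "R x (noise_seq \<epsilon> \<omega>) e1 \<longleftrightarrow>
      recurrently_separated r \<delta> (\<lambda>t. \<epsilon> (Suc t) \<omega>) (r x + \<epsilon> 1 \<omega>) (r x + e1)" for x e1 \<omega>
    by (simp add: R_def)
  have tail_noise: "recurrently_separated r \<delta> (noise_seq (\<lambda>t. \<epsilon> (Suc t)) \<omega>) x y \<longleftrightarrow>
      recurrently_separated r \<delta> (\<lambda>t. \<epsilon> (Suc t) \<omega>) x y" for x y \<omega>
    by (rule recurrently_separated_cong) simp
  have coord[measurable (raw)]: "(\<lambda>e. e t) \<in> borel_measurable noise_space" if "t \<ge> 1" for t
    using that by (intro measurable_component_singleton) auto
  have coord': "(\<lambda>w. g w t) \<in> borel_measurable N" if "g \<in> measurable N noise_space" "t \<ge> 1" for g t N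
    by (rule measurable_compose[OF that(1) coord[OF that(2)]])
  have "AE z in lborel \<Otimes>\<^sub>M lborel. AE \<omega> in P.
      recurrently_separated r \<delta> (\<lambda>t. \<epsilon> (Suc t) \<omega>) (snd z) (fst z)"
    using sep unfolding lborel_prod by (subst recurrently_separated_sym)
  then have "AE x' in lborel. AE x in lborel. AE \<omega> in P.
      recurrently_separated r \<delta> (\<lambda>t. \<epsilon> (Suc t) \<omega>) x x'"
    by (auto dest: lborel_pair.AE_pair)
  then obtain B where B: "B \<in> null_sets lborel"
    and sep_B: "\<And>x'. x' \<notin> B \<Longrightarrow> AE x in lborel. AE \<omega> in P. recurrently_separated r \<delta> (\<lambda>t. \<epsilon> (Suc t) \<omega>) x x'"
    by (auto elim!: AE_E3)
  have [measurable]: "B \<in> sets borel" using B by (auto simp: null_sets_def)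
  \<comment> \<open>The replaced innovation is to be fixed first, but the null set that it must avoid depends on
    the initial state; exchanging the two quantifiers allows the initial state to be fixed
    first.\<close>
  have "AE \<omega>' in P. AE \<omega> in P. r (X0 \<omega>) + \<epsilon>1' \<omega>' \<notin> B"
  proof (subst PP.AE_commute)
    have "AE \<omega>' in P. r x + \<epsilon>1' \<omega>' \<notin> B" for x
    proof -
      have "AE e in lborel. r x + e \<notin> B"
        by (rule AE_lborel_translate[OF AE_not_in[OF B]])
      then have "AE e in density lborel (\<lambda>u. ennreal (\<phi> u)). r x + e \<notin> B"
        by (subst AE_density) auto
      then have "AE e in distr P borel \<epsilon>1'. r x + e \<notin> B"
        unfolding \<epsilon>1'_distr distr_noise[OF order_refl] .
      then show ?thesis by (rule AE_distrD[rotated]) measurable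
    qed
    then show "AE \<omega> in P. AE \<omega>' in P. r (X0 \<omega>) + \<epsilon>1' \<omega>' \<notin> B" by simp
  qed measurable
  then have "AE \<omega>' in P. AE \<omega> in P. R (X0 \<omega>) (noise_seq \<epsilon> \<omega>) (\<epsilon>1' \<omega>')"
  proof (rule AE_mp[OF _ AE_I2], intro impI)
    fix \<omega>'
    define e1 where "e1 = \<epsilon>1' \<omega>'"
    assume "AE \<omega> in P. r (X0 \<omega>) + \<epsilon>1' \<omega>' \<notin> B"
    then have "AE \<omega>'' in P. AE \<omega> in P. R (X0 \<omega>'') (noise_seq \<epsilon> \<omega>) e1"
    proof (rule AE_mp[OF _ AE_I2], intro impI)
      fix \<omega>''
      define x0 where "x0 = X0 \<omega>''"
      assume "r (X0 \<omega>'') + \<epsilon>1' \<omega>' \<notin> B"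
      then have "AE x in lborel. AE \<omega> in P. recurrently_separated r \<delta> (\<lambda>t. \<epsilon> (Suc t) \<omega>) x (r x0 + e1)"
        by (intro sep_B) (simp add: x0_def e1_def)
      then have "AE u in lborel. AE \<omega> in P.
          recurrently_separated r \<delta> (\<lambda>t. \<epsilon> (Suc t) \<omega>) (r x0 + u) (r x0 + e1)"
        by (rule AE_lborel_translate)
      then have "AE \<upsilon> in P. AE \<omega> in P.
          recurrently_separated r \<delta> (\<lambda>t. \<epsilon> (Suc t) \<omega>) (r x0 + \<epsilon> 1 \<upsilon>) (r x0 + e1)"
        by (intro AE_noiseI) auto
      then have "AE \<upsilon> in P. AE \<omega> in P. recurrently_separated r \<delta> (noise_seq (\<lambda>t. \<epsilon> (Suc t)) \<omega>)
          (r x0 + \<epsilon> 1 \<upsilon>) (r x0 + e1)"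
        by (simp only: tail_noise)
      moreover have "{p \<in> space (borel \<Otimes>\<^sub>M noise_space).
          recurrently_separated r \<delta> (snd p) (r x0 + fst p) (r x0 + e1)} \<in> sets (borel \<Otimes>\<^sub>M noise_space)"
        by (intro sets_recurrently_separated r coord'[OF measurable_snd]) measurable
      ultimately have "AE \<omega> in P. recurrently_separated r \<delta> (noise_seq (\<lambda>t. \<epsilon> (Suc t)) \<omega>)
          (r x0 + \<epsilon> 1 \<omega>) (r x0 + e1)"
        by (intro AE_product_lawI[OF product_law_first_rest,
              where Q="\<lambda>u s. recurrently_separated r \<delta> s (r x0 + u) (r x0 + e1)"])
      then show "AE \<omega> in P. R (X0 \<omega>'') (noise_seq \<epsilon> \<omega>) e1"
        by (simp only: tail_noise R_noise x0_def)
    qed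
    moreover have "{p \<in> space (borel \<Otimes>\<^sub>M noise_space). R (fst p) (snd p) e1}
        \<in> sets (borel \<Otimes>\<^sub>M noise_space)"
    proof -
      have [measurable]: "(\<lambda>p. snd p 1) \<in> borel_measurable (borel \<Otimes>\<^sub>M noise_space)"
        by (rule coord'[OF measurable_snd]) simp
      show ?thesis
        unfolding R_def
        by (intro sets_recurrently_separated r coord'[OF measurable_snd]) measurable
    qed
    ultimately show "AE \<omega> in P. R (X0 \<omega>) (noise_seq \<epsilon> \<omega>) (\<epsilon>1' \<omega>')"
      unfolding e1_def[symmetric]
      by (intro AE_product_lawI[OF product_law_if_indep_rv[OF X0_noise X0 noise_seq_measurable],
              where Q="\<lambda>x e. R x e e1"])
  qed
  moreover have "{p \<in> space (borel \<Otimes>\<^sub>M (borel \<Otimes>\<^sub>M noise_space)). R (fst (snd p)) (snd (snd p)) (fst p)}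
      \<in> sets (borel \<Otimes>\<^sub>M (borel \<Otimes>\<^sub>M noise_space))"
  proof -
    have [measurable]: "(\<lambda>p. snd (snd p) t) \<in> borel_measurable (borel \<Otimes>\<^sub>M (borel \<Otimes>\<^sub>M noise_space))"
      if "t \<ge> 1" for t
      using that by (intro coord'[of "\<lambda>p. snd (snd p)"]) measurable
    have [measurable]: "(\<lambda>p. snd (snd p) 1) \<in> borel_measurable (borel \<Otimes>\<^sub>M (borel \<Otimes>\<^sub>M noise_space))"
      by measurable
    show ?thesis
      unfolding R_def by (intro sets_recurrently_separated r) measurable
  qed
  ultimately have "AE \<omega> in P. R (X0 \<omega>) (noise_seq \<epsilon> \<omega>) (\<epsilon>1' \<omega>)"
    using AE_product_lawI[OF product_law_if_indep_rv[OF \<epsilon>1'_indep \<epsilon>1'],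
        where Q="\<lambda>e1 xe. R (fst xe) (snd xe) e1"] by simp
  then show ?thesis by (simp only: R_noise)
qed

end

section \<open>Positive exponents and non-contracting orbits\<close>

text \<open>A non-measurable event has probability 0 by convention.\<close>

lemma prob_eq_0_if_AE_not:
  assumes "AE \<omega> in M. \<not> Q \<omega>"
  shows "\<P>(\<omega> in M. Q \<omega>) = 0"
proof (cases "{\<omega> \<in> space M. Q \<omega>} \<in> sets M")
  case True
  then have "emeasure M {\<omega> \<in> space M. Q \<omega>} = 0"
    using assms by (subst (asm) AE_iff_measurable[OF True]) auto
  then show ?thesis by (simp add: measure_def)
qed (rule measure_notin_sets)

theorem proposition3p3:
  fixes f f\<epsilon> :: "real \<Rightarrow> real" and T :: real
    and P :: "'w measure" and \<epsilon> :: "nat \<Rightarrow> 'w \<Rightarrow> real"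
  assumes f_C1: "f C1_differentiable_on UNIV"
    and T_pos: "T > 0"
    and f_periodic: "\<forall>x. f (x + T) = f x"
    and f'_norm: "(SUP x. \<bar>deriv f x\<bar>) = 1"
    and P: "prob_space P"
    and \<epsilon>_indep: "prob_space.indep_vars P (\<lambda>_. borel) \<epsilon> {1..}"
    and \<epsilon>_density: "\<forall>t\<ge>1. distributed P lborel (\<epsilon> t) (\<lambda>u. ennreal (f\<epsilon> u))"
    and f\<epsilon>_nonneg: "\<forall>u. f\<epsilon> u \<ge> 0"
    and M_finite: "periodized_sup f\<epsilon> T < \<infinity>"
    and log_f': "(\<integral>\<^sup>+ u\<in>{0..T}. log_minus \<bar>deriv f u\<bar> \<partial>lborel) < \<infinity>"
    and cond: "\<forall>a. a \<noteq> 0 \<longrightarrow> (\<exists>\<delta>0>0. small_derivative_condition (\<lambda>x. a * f x) T \<delta>0)"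
  shows "C_eps f f\<epsilon> T < \<infinity> \<and>
    (\<forall>a \<pi>. a \<noteq> 0 \<longrightarrow>
       invariant_prob (\<lambda>x. a * f x) (density lborel (\<lambda>u. ennreal (f\<epsilon> u))) \<pi> \<longrightarrow>
       has_lebesgue_density \<pi> \<longrightarrow>
       lyapunov f a \<pi> \<ge> ereal (ln \<bar>a\<bar>) - enn2ereal (C_eps f f\<epsilon> T)) \<and>
    (\<exists>k0::real. \<forall>a. a \<noteq> 0 \<longrightarrow> \<bar>a\<bar> > k0 \<longrightarrow>
       (\<forall>\<pi>. invariant_prob (\<lambda>x. a * f x) (density lborel (\<lambda>u. ennreal (f\<epsilon> u))) \<pi> \<longrightarrow>
          has_lebesgue_density \<pi> \<longrightarrow> lyapunov f a \<pi> > 0) \<and>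
       ((\<forall>u. f\<epsilon> u > 0) \<and> (\<forall>l h. \<exists>c>0. \<forall>u\<in>{l..h}. c \<le> f\<epsilon> u) \<longrightarrow>
          (\<forall>\<pi> (X0 :: 'w \<Rightarrow> real) (\<epsilon>1' :: 'w \<Rightarrow> real).
             invariant_prob (\<lambda>x. a * f x) (density lborel (\<lambda>u. ennreal (f\<epsilon> u))) \<pi> \<longrightarrow>
             has_lebesgue_density \<pi> \<longrightarrow>
             X0 \<in> borel_measurable P \<longrightarrow> distr P borel X0 = \<pi> \<longrightarrow>
             indep_rv P borel X0 noise_space (noise_seq \<epsilon>) \<longrightarrow>
             \<epsilon>1' \<in> borel_measurable P \<longrightarrow> distr P borel \<epsilon>1' = distr P borel (\<epsilon> 1) \<longrightarrow>
             indep_rv P borel \<epsilon>1' (borel \<Otimes>\<^sub>M noise_space) (\<lambda>\<omega>. (X0 \<omega>, noise_seq \<epsilon> \<omega>)) \<longrightarrow>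
             \<P>(\<omega> in P. (\<lambda>n. chain_diff (\<lambda>x. a * f x) (X0 \<omega>) (\<lambda>t. \<epsilon> t \<omega>) (\<epsilon>1' \<omega>) n)
                \<longlonglongrightarrow> 0) = 0) \<and>
          (AE (x, y) in (lborel :: (real \<times> real) measure).
             \<P>(\<omega> in P. (\<lambda>n. \<bar>forward_comp (\<lambda>x. a * f x) (\<lambda>t. \<epsilon> t \<omega>) n x
                - forward_comp (\<lambda>x. a * f x) (\<lambda>t. \<epsilon> t \<omega>) n y\<bar>) \<longlonglongrightarrow> 0) = 0)))"
proof -
  interpret iid_noise P \<epsilon> f\<epsilon>
    using P \<epsilon>_indep \<epsilon>_density by (simp add: iid_noise_def iid_noise_axioms_def)
  interpret f: periodic_C1_map f T
    using f_C1 T_pos f_periodic f'_norm by (intro periodic_C1_mapI) auto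
  define \<nu> where "\<nu> = density lborel (\<lambda>u. ennreal (f\<epsilon> u))"
  have C_fin: "C_eps f f\<epsilon> T < \<infinity>"
    using M_finite log_f' by (simp add: f.C_eps_eq ennreal_mult_less_top)
  have lyapunov_bound: "lyapunov f a \<pi> \<ge> ereal (ln \<bar>a\<bar>) - enn2ereal (C_eps f f\<epsilon> T)"
    if "a \<noteq> 0" "invariant_prob (\<lambda>x. a * f x) (density lborel (\<lambda>u. ennreal (f\<epsilon> u))) \<pi>" for a \<pi>
    by (rule f.lyapunov_ge[OF that(2) density_measurable prob_space_density that(1) C_fin])

  \<comment> \<open>The difference quotients in the drift estimate are those of \<open>f\<close> itself, so the condition for
    \<open>a = 1\<close> gives a bound \<open>L\<close>, and hence a threshold, common to all \<open>a\<close>.\<close>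
  obtain \<delta>0 where "\<delta>0 > 0" "small_derivative_condition (\<lambda>x. 1 * f x) T \<delta>0"
    using cond zero_neq_one by metis
  then obtain \<delta> L where \<delta>: "\<delta> > 0" and L: "L \<ge> 0"
    "\<And>d. 0 < \<bar>d\<bar> \<Longrightarrow> \<bar>d\<bar> \<le> \<delta> \<Longrightarrow>
      (\<integral>\<^sup>+u\<in>{0..T}. log_minus (\<bar>f (u + d) - f u\<bar> / \<bar>d\<bar>) \<partial>lborel) \<le> ennreal L"
    using f.difference_quotient_log_bound[of \<delta>0] by auto
  define C where "C = enn2real (C_eps f f\<epsilon> T)"
  define B where "B = enn2real (periodized_sup f\<epsilon> T) * L"
  have CB: "C \<ge> 0" "B \<ge> 0" using L(1) by (simp_all add: C_def B_def)
  have C_eq: "C_eps f f\<epsilon> T = ennreal C" using C_fin by (simp add: C_def)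
  have B_eq: "periodized_sup f\<epsilon> T * ennreal L = ennreal B"
    using M_finite L(1) by (simp add: B_def ennreal_mult)

  \<comment> \<open>The threshold \<open>exp (C + B)\<close> makes \<open>ln \<bar>a\<bar>\<close> exceed both \<open>C\<close>, which yields a positive
    exponent, and \<open>B\<close>, which yields the drift.\<close>
  have large: "(\<forall>\<pi>. invariant_prob (\<lambda>x. a * f x) (density lborel (\<lambda>u. ennreal (f\<epsilon> u))) \<pi> \<longrightarrow>
          has_lebesgue_density \<pi> \<longrightarrow> lyapunov f a \<pi> > 0) \<and>
       ((\<forall>u. f\<epsilon> u > 0) \<and> (\<forall>l h. \<exists>c>0. \<forall>u\<in>{l..h}. c \<le> f\<epsilon> u) \<longrightarrow>
          (\<forall>\<pi> (X0 :: 'w \<Rightarrow> real) (\<epsilon>1' :: 'w \<Rightarrow> real).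
             invariant_prob (\<lambda>x. a * f x) (density lborel (\<lambda>u. ennreal (f\<epsilon> u))) \<pi> \<longrightarrow>
             has_lebesgue_density \<pi> \<longrightarrow>
             X0 \<in> borel_measurable P \<longrightarrow> distr P borel X0 = \<pi> \<longrightarrow>
             indep_rv P borel X0 noise_space (noise_seq \<epsilon>) \<longrightarrow>
             \<epsilon>1' \<in> borel_measurable P \<longrightarrow> distr P borel \<epsilon>1' = distr P borel (\<epsilon> 1) \<longrightarrow>
             indep_rv P borel \<epsilon>1' (borel \<Otimes>\<^sub>M noise_space) (\<lambda>\<omega>. (X0 \<omega>, noise_seq \<epsilon> \<omega>)) \<longrightarrow>
             \<P>(\<omega> in P. (\<lambda>n. chain_diff (\<lambda>x. a * f x) (X0 \<omega>) (\<lambda>t. \<epsilon> t \<omega>) (\<epsilon>1' \<omega>) n)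
                \<longlonglongrightarrow> 0) = 0) \<and>
          (AE (x, y) in (lborel :: (real \<times> real) measure).
             \<P>(\<omega> in P. (\<lambda>n. \<bar>forward_comp (\<lambda>x. a * f x) (\<lambda>t. \<epsilon> t \<omega>) n x
                - forward_comp (\<lambda>x. a * f x) (\<lambda>t. \<epsilon> t \<omega>) n y\<bar>) \<longlonglongrightarrow> 0) = 0))"
    if a: "a \<noteq> 0" "\<bar>a\<bar> > exp (C + B)" for a
  proof -
    define r where "r = (\<lambda>x. a * f x)"
    define V where "V d = log_minus (\<bar>d\<bar> / (\<delta> * \<bar>a\<bar>))" for d
    have ln_a: "ln \<bar>a\<bar> > C + B" using a by (metis exp_less_cancel_iff exp_ln zero_less_abs_iff)
    have a1: "\<bar>a\<bar> \<ge> 1" using a(2) CB one_le_exp_iff[of "C + B"] by linarith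
    have r_meas: "r \<in> borel_measurable borel" unfolding r_def by measurable
    have V_meas: "V \<in> borel_measurable borel" unfolding V_def by measurable
    have V_fin: "V d < \<infinity>" if "d \<noteq> 0" for d
      using that a(1) \<delta> by (simp add: V_def log_minus_def)
    have c: "ennreal (ln \<bar>a\<bar> - B) > 0" using ln_a CB by simp
    have drift: "(\<integral>\<^sup>+e. V (r (p + e) - r (q + e)) * ennreal (f\<epsilon> e) \<partial>lborel) + ennreal (ln \<bar>a\<bar> - B)
        \<le> V (p - q)" if "\<bar>p - q\<bar> \<le> \<delta>" for p q
    proof -
      let ?I = "\<integral>\<^sup>+e. V (r (p + e) - r (q + e)) * ennreal (f\<epsilon> e) \<partial>lborel"
      have "ennreal B + (?I + ennreal (ln \<bar>a\<bar> - B)) = ?I + (ennreal (ln \<bar>a\<bar> - B) + ennreal B)"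
        by (simp add: ac_simps)
      also have "ennreal (ln \<bar>a\<bar> - B) + ennreal B = ennreal (ln \<bar>a\<bar>)"
        using ln_a CB by (simp add: ennreal_plus[symmetric] del: ennreal_plus)
      also have "?I + ennreal (ln \<bar>a\<bar>) \<le> V (p - q) + periodized_sup f\<epsilon> T * ennreal L"
        unfolding V_def r_def
        by (rule f.log_distance_drift[OF density_measurable prob_space_density a1 that L(2)])
      finally show ?thesis by (simp add: B_eq add.commute[of _ "ennreal B"])
    qed
    have null: "negligible {x. r x \<in> N}" if "negligible N" for N
    proof (rule negligible_vimage_nonzero_deriv[where g'="\<lambda>x. a * deriv f x", OF _ _ that])
      show "(r has_real_derivative a * deriv f x) (at x)" for x
        unfolding r_def by (intro DERIV_cmult f.has_deriv)
      show "negligible {x. a * deriv f x = 0}" using a(1) f.negligible_critical_points[OF log_f'] by simp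
    qed
    have separated: "AE z in (lborel :: (real \<times> real) measure). AE \<omega> in P.
        recurrently_separated r \<delta> (\<lambda>t. \<epsilon> t \<omega>) (fst z) (snd z)"
      by (rule AE_recurrently_separated[OF r_meas V_meas V_fin c drift null])
    have separated_tail: "AE z in (lborel :: (real \<times> real) measure). AE \<omega> in P.
        recurrently_separated r \<delta> (\<lambda>t. \<epsilon> (Suc t) \<omega>) (fst z) (snd z)"
      by (rule iid_noise.AE_recurrently_separated[OF iid_noise_shift r_meas V_meas V_fin c drift null])

    have "lyapunov f a \<pi> > 0"
      if "invariant_prob (\<lambda>x. a * f x) (density lborel (\<lambda>u. ennreal (f\<epsilon> u))) \<pi>" for \<pi>
    proof -
      have "0 < ereal (ln \<bar>a\<bar>) - enn2ereal (C_eps f f\<epsilon> T)"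
        using ln_a CB by (simp add: C_eq enn2ereal_ennreal)
      also have "\<dots> \<le> lyapunov f a \<pi>" by (rule lyapunov_bound[OF a(1) that])
      finally show ?thesis .
    qed
    moreover have "\<P>(\<omega> in P. (\<lambda>n. chain_diff r (X0 \<omega>) (\<lambda>t. \<epsilon> t \<omega>) (\<epsilon>1' \<omega>) n) \<longlonglongrightarrow> 0) = 0"
      if "X0 \<in> borel_measurable P" "indep_rv P borel X0 noise_space (noise_seq \<epsilon>)"
        "\<epsilon>1' \<in> borel_measurable P" "distr P borel \<epsilon>1' = distr P borel (\<epsilon> 1)"
        "indep_rv P borel \<epsilon>1' (borel \<Otimes>\<^sub>M noise_space) (\<lambda>\<omega>. (X0 \<omega>, noise_seq \<epsilon> \<omega>))"
      for X0 \<epsilon>1' :: "'w \<Rightarrow> real"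
    proof (rule prob_eq_0_if_AE_not)
      show "AE \<omega> in P. \<not> (\<lambda>n. chain_diff r (X0 \<omega>) (\<lambda>t. \<epsilon> t \<omega>) (\<epsilon>1' \<omega>) n) \<longlonglongrightarrow> 0"
        using AE_chain_diff_separated[OF r_meas separated_tail that]
      proof eventually_elim
        case (elim \<omega>)
        from recurrently_separated_not_tendsto[OF this \<delta>]
        have "\<not> (\<lambda>n. chain_diff r (X0 \<omega>) (\<lambda>t. \<epsilon> t \<omega>) (\<epsilon>1' \<omega>) (Suc n)) \<longlonglongrightarrow> 0"
          unfolding chain_diff_Suc .
        then show ?case using LIMSEQ_Suc by blast
      qed
    qed
    moreover have "AE (x, y) in (lborel :: (real \<times> real) measure).
        \<P>(\<omega> in P. (\<lambda>n. \<bar>forward_comp r (\<lambda>t. \<epsilon> t \<omega>) n x - forward_comp r (\<lambda>t. \<epsilon> t \<omega>) n y\<bar>) \<longlonglongrightarrow> 0) = 0"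
      using separated
    proof eventually_elim
      case (elim z)
      then have "AE \<omega> in P. \<not> (\<lambda>n. \<bar>forward_comp r (\<lambda>t. \<epsilon> t \<omega>) n (fst z)
          - forward_comp r (\<lambda>t. \<epsilon> t \<omega>) n (snd z)\<bar>) \<longlonglongrightarrow> 0"
        by eventually_elim (simp add: tendsto_rabs_zero_iff recurrently_separated_not_tendsto[OF _ \<delta>])
      then show ?case unfolding case_prod_beta by (rule prob_eq_0_if_AE_not)
    qed
    ultimately show ?thesis unfolding r_def by blast
  qed
  show ?thesis using C_fin lyapunov_bound large by blast
qed

end
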